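(* Every irreducible element of $K[T,\phi]$ is similar to an element of the form $P^{[\mu]}$ with $P\in k[T^\ell,\sigma^\ell]$ irreducible, where $\ell=\ell_b(\mu)$.
   Context: Setting: $p$ is a prime, $k$ is a perfect field of characteristic $p$, $K = k((u))$ is the field of formal Laurent series over $k$, $\sigma$ is a power of the Frobenius automorphism of $k$ (possibly $\sigma=\mathrm{id}$), $b\ge 2$ is an integer, and $\phi: K\to K$ is the endomorphism $\phi(\sum_n a_n u^n) = \sum_n \sigma(a_n)u^{bn}$. The ring $K[T,\phi]$ is the set of polynomials $\sum a_iT^i$ with usual addition and multiplication determined by $Ta=\phi(a)T$ for $a\in K$; similarly $k[T,\sigma]$ with $Ta=\sigma(a)T$ for $a \in k$. $k[T^\ell,\sigma^\ell]$ is the ring of skew polynomials in $T^\ell$ with coefficients in $k$, viewed inside $k[T,\sigma]$. Similarity: two elements $A,B$ of $R=K[T,\phi]$ are similar if the left $R$-modules $R/RA$ and $R/RB$ are isomorphic. $b$-length: for $\mu\in\mathbf{Q}^\times$ write $\mu=b^\alpha\frac{s}{t}$ with $\alpha\in\mathbf{Z}$, $s\in\mathbf{Z}$ and $t\in\mathbf{Z}\setminus\{0\}$ coprime, and $t$ coprime to $b$. The $b$-length $\ell_b(\mu)$ is the order of $b$ modulo $t$ (or $0$ if $t=1$). Notation $P^{[\mu]}$: for $\mu\in\mathbf{Q}^\times$ with $\ell_b(\mu)=\ell$ and $P\in k[T^\ell,\sigma^\ell]$, $P^{[\mu]}=u^{-\mu}Pu^{\mu}\in K[T,\phi]$, where $\phi$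 is extended to fractional powers of $u$ by $\phi(u^q)=u^{bq}$.
   Formalization: When t = 1 (b-length 0), k[T^ℓ,σ^ℓ] is taken to be all of k[T,σ], i.e. ℓ is read as 1; literally k[T^0,σ^0] = k has no irreducible elements and the claim would fail, e.g. for T − 1. *)

theory Defs
  imports
    "HOL-Computational_Algebra.Formal_Laurent_Series"
    "HOL-Computational_Algebra.Polynomial"
    "HOL-Number_Theory.Pocklington"
    "HOL-Algebra.Ideal"
    "HOL-Algebra.Module"
begin

text \<open>The powers of Frobenius are taken in the automorphism group of a perfect field, so negative
  exponents are included.\<close>

definition is_frobenius_power :: "nat \<Rightarrow> ('k::field \<Rightarrow> 'k) \<Rightarrow> bool" where
  "is_frobenius_power p \<sigma> \<longleftrightarrow>
     (\<exists>n::nat. \<sigma> = (\<lambda>x. x ^ p) ^^ n \<or> \<sigma> = (inv_into UNIV (\<lambda>x. x ^ p)) ^^ n)"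

definition fls_twist :: "('k::field \<Rightarrow> 'k) \<Rightarrow> nat \<Rightarrow> 'k fls \<Rightarrow> 'k fls" where
  "fls_twist \<sigma> b f = fls_compose_power (Abs_fls (\<lambda>n. \<sigma> (fls_nth f n))) b"

lemma fls_nth_fls_twist:
  assumes "\<sigma> 0 = 0" "b > 0"
  shows "fls_nth (fls_twist \<sigma> b f) n =
           (if int b dvd n then \<sigma> (fls_nth f (n div int b)) else 0)"
proof -
  have "\<forall>\<^sub>\<infinity>n::nat. \<sigma> (fls_nth f (- int n)) = 0"
    using assms(1) by (auto intro: MOST_mono[OF MOST_fls_neg_nth_eq_0[of f]])
  thus ?thesis using assms(2) by (simp add: fls_twist_def fls_nth_compose_power)
qed


subsection \<open>Skew polynomials\<close>

text \<open>A skew polynomial \<open>\<Sum> a\<^sub>i T\<^sup>i\<close> is represented by the type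
  \<open>poly\<close>, of which only the additive structure is used; the product extends
  \<open>(a T\<^sup>i) (c T\<^sup>j) = a \<phi>\<^sup>i(c) T\<^bsup>i+j\<^esup>\<close>.\<close>

definition skew_mult :: "('a::comm_ring_1 \<Rightarrow> 'a) \<Rightarrow> 'a poly \<Rightarrow> 'a poly \<Rightarrow> 'a poly" where
  "skew_mult \<phi> P Q =
     (\<Sum>i\<le>degree P. \<Sum>j\<le>degree Q. Polynomial.monom (poly.coeff P i * (\<phi> ^^ i) (poly.coeff Q j)) (i + j))"

definition skew_poly_ring :: "('a::comm_ring_1 \<Rightarrow> 'a) \<Rightarrow> 'a poly ring" where
  "skew_poly_ring \<phi> =
     \<lparr>carrier = UNIV, mult = skew_mult \<phi>, one = 1, zero = 0, add = (+)\<rparr>"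

lemma skew_mult_bound:
  fixes \<phi> :: "'a::comm_ring_1 \<Rightarrow> 'a"
  assumes z: "\<phi> 0 = 0" and "degree P \<le> m" "degree Q \<le> n"
  shows "skew_mult \<phi> P Q = (\<Sum>i\<le>m. \<Sum>j\<le>n. Polynomial.monom (poly.coeff P i * (\<phi> ^^ i) (poly.coeff Q j)) (i + j))"
proof -
  have z': "(\<phi> ^^ i) 0 = 0" for i by (induction i) (auto simp: z)
  have "(\<Sum>j\<le>degree Q. Polynomial.monom (poly.coeff P i * (\<phi> ^^ i) (poly.coeff Q j)) (i + j)) = (\<Sum>j\<le>n. Polynomial.monom (poly.coeff P i * (\<phi> ^^ i) (poly.coeff Q j)) (i + j))" for i
    by (rule sum.mono_neutral_left) (use assms in \<open>auto simp: z' coeff_eq_0\<close>)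
  then have "skew_mult \<phi> P Q = (\<Sum>i\<le>degree P. \<Sum>j\<le>n. Polynomial.monom (poly.coeff P i * (\<phi> ^^ i) (poly.coeff Q j)) (i + j))"
    by (simp add: skew_mult_def)
  also have "\<dots> = (\<Sum>i\<le>m. \<Sum>j\<le>n. Polynomial.monom (poly.coeff P i * (\<phi> ^^ i) (poly.coeff Q j)) (i + j))"
    by (rule sum.mono_neutral_left) (use assms in \<open>auto simp: coeff_eq_0\<close>)
  finally show ?thesis .
qed

locale skew_endo =
  fixes \<phi> :: "'a::comm_ring_1 \<Rightarrow> 'a"
  assumes add: "\<phi> (x + y) = \<phi> x + \<phi> y" and mult: "\<phi> (x * y) = \<phi> x * \<phi> y" and one: "\<phi> 1 = 1"
begin

lemma zero: "\<phi> 0 = 0" using add[of 0 0] by simp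
lemma funpow_hom: "(\<phi> ^^ i) (x + y) = (\<phi> ^^ i) x + (\<phi> ^^ i) y" "(\<phi> ^^ i) (x * y) = (\<phi> ^^ i) x * (\<phi> ^^ i) y" "(\<phi> ^^ i) 1 = 1" "(\<phi> ^^ i) 0 = 0"
  by (induction i) (auto simp: add mult one zero)

lemma skew_mult_monom: "skew_mult \<phi> (Polynomial.monom a i) (Polynomial.monom c j) = Polynomial.monom (a * (\<phi> ^^ i) c) (i + j)"
proof -
  have "skew_mult \<phi> (Polynomial.monom a i) (Polynomial.monom c j) = (\<Sum>i'\<le>i. \<Sum>j'\<le>j. Polynomial.monom (poly.coeff (Polynomial.monom a i) i' * (\<phi> ^^ i') (poly.coeff (Polynomial.monom c j) j')) (i' + j'))"
    by (rule skew_mult_bound) (auto simp: zero degree_monom_le)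
  also have "\<dots> = (\<Sum>i'\<le>i. \<Sum>j'\<le>j. if i' = i \<and> j' = j then Polynomial.monom (a * (\<phi> ^^ i) c) (i + j) else 0)"
    by (intro sum.cong) (auto simp: funpow_hom)
  also have "\<dots> = (\<Sum>i'\<le>i. if i' = i then Polynomial.monom (a * (\<phi> ^^ i) c) (i + j) else 0)"
    by (intro sum.cong) auto
  finally show ?thesis by simp
qed

lemma skew_add_left: "skew_mult \<phi> (P + P') Q = skew_mult \<phi> P Q + skew_mult \<phi> P' Q"
proof -
  let ?m = "max (degree P) (degree P')"
  show ?thesis
    using degree_add_le_max[of P P']
    by (simp add: skew_mult_bound[where \<phi> = \<phi> and m = ?m and n = "degree Q", OF zero] ring_distribs Polynomial.add_monom[symmetric] sum.distrib)
qed

lemma skew_add_right: "skew_mult \<phi> P (Q + Q') = skew_mult \<phi> P Q + skew_mult \<phi> P Q'"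
proof -
  let ?m = "max (degree Q) (degree Q')"
  show ?thesis
    using degree_add_le_max[of Q Q']
    by (simp add: skew_mult_bound[where \<phi> = \<phi> and n = ?m and m = "degree P", OF zero] funpow_hom ring_distribs Polynomial.add_monom[symmetric] sum.distrib)
qed

lemma poly_add_induct:
  assumes "\<And>a i. R (Polynomial.monom a i)" "\<And>p q. R p \<Longrightarrow> R q \<Longrightarrow> R (p + q)"
  shows "R (p :: 'a poly)"
proof -
  have "R (\<Sum>i\<le>n. Polynomial.monom (poly.coeff p i) i)" for n
    by (induction n) (auto intro: assms)
  thus ?thesis by (metis poly_as_sum_of_monoms)
qed

lemma skew_assoc: "skew_mult \<phi> (skew_mult \<phi> P Q) S = skew_mult \<phi> P (skew_mult \<phi> Q S)"
proof (induction P rule: poly_add_induct)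
  case (1 a i) show ?case
  proof (induction Q rule: poly_add_induct)
    case (1 c j) show ?case
    proof (induction S rule: poly_add_induct)
      case (1 e l) show ?case by (simp add: skew_mult_monom funpow_hom funpow_add algebra_simps)
    qed (simp add: skew_add_left skew_add_right)
  qed (simp add: skew_add_left skew_add_right)
qed (simp add: skew_add_left skew_add_right)

lemma one_monom: "(1 :: 'a poly) = Polynomial.monom 1 0"
  by (simp add: Polynomial.monom_0 one_pCons)

lemma skew_one_left: "skew_mult \<phi> 1 P = P"
  unfolding one_monom
  by (induction P rule: poly_add_induct) (simp_all add: skew_add_right skew_mult_monom funpow_hom del: monom_eq_1)

lemma skew_one_right: "skew_mult \<phi> P 1 = P"
  unfolding one_monom
  by (induction P rule: poly_add_induct) (simp_all add: skew_add_left skew_mult_monom funpow_hom del: monom_eq_1)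

lemma ring_skew: "ring (skew_poly_ring \<phi>)"
proof (rule ringI)
  show "abelian_group (skew_poly_ring \<phi>)"
    by (rule abelian_groupI) (auto simp: skew_poly_ring_def intro: exI[of _ "- x" for x] left_minus)
  show "Group.monoid (skew_poly_ring \<phi>)"
    by (rule monoidI) (auto simp: skew_poly_ring_def skew_assoc skew_one_left skew_one_right)
qed (auto simp: skew_poly_ring_def skew_add_left skew_add_right)

end

text \<open>The subring \<open>k[T\<^sup>l, \<sigma>\<^sup>l]\<close> of \<open>k[T, \<sigma>]\<close>.  The value
  \<open>l = 0\<close> is not a genuine exponent: it is the marker returned by \<open>b_length\<close> below for
  denominator \<open>1\<close>, where the order of \<open>b\<close> is \<open>1\<close> and
  \<open>u\<^bsup>-\<mu>\<^esup> T u\<^bsup>\<mu>\<^esup>\<close> already has coefficients in \<open>k((u))\<close>.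
  So \<open>l = 0\<close> stands for the whole of \<open>k[T, \<sigma>]\<close> (the field \<open>k\<close> obtained
  from \<open>T\<^sup>0 = 1\<close> has no irreducible elements).\<close>

definition skew_poly_subring :: "('a::comm_ring_1 \<Rightarrow> 'a) \<Rightarrow> nat \<Rightarrow> 'a poly ring" where
  "skew_poly_subring \<sigma> l = (skew_poly_ring \<sigma>)
     \<lparr>carrier := {P. \<forall>i. poly.coeff P i \<noteq> 0 \<longrightarrow> (if l = 0 then 1 else l) dvd i}\<rparr>"

text \<open>Irreducibility in a possibly non-commutative domain; the constant \<open>irreducible\<close> of
  \<open>HOL-Algebra\<close> is phrased through one-sided divisibility and meant for commutative monoids.\<close>

definition nc_irreducible :: "('a, 'm) ring_scheme \<Rightarrow> 'a \<Rightarrow> bool" where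
  "nc_irreducible R a \<longleftrightarrow>
     a \<in> carrier R \<and> a \<noteq> \<zero>\<^bsub>R\<^esub> \<and> a \<notin> Units R \<and>
     (\<forall>x\<in>carrier R. \<forall>y\<in>carrier R. a = x \<otimes>\<^bsub>R\<^esub> y \<longrightarrow> x \<in> Units R \<or> y \<in> Units R)"


subsection \<open>Similarity\<close>

text \<open>The left module \<open>R/RA\<close>; \<open>PIdl\<^bsub>R\<^esub> A\<close> is
  \<open>{x \<otimes> A | x}\<close>, i.e. the left ideal \<open>RA\<close>.  The fields \<open>mult\<close> and
  \<open>one\<close> of the record have no meaning for a module.\<close>

definition left_quotient :: "('a, 'm) ring_scheme \<Rightarrow> 'a \<Rightarrow> ('a, 'a set) module" where
  "left_quotient R A =
     \<lparr>carrier = a_rcosets\<^bsub>R\<^esub> (PIdl\<^bsub>R\<^esub> A), mult = undefined, one = undefined,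
      zero = PIdl\<^bsub>R\<^esub> A, add = set_add R,
      smult = (\<lambda>r X. \<Union>x\<in>X. PIdl\<^bsub>R\<^esub> A +>\<^bsub>R\<^esub> (r \<otimes>\<^bsub>R\<^esub> x))\<rparr>"

definition left_module_iso ::
  "('a, 'm) ring_scheme \<Rightarrow> ('a, 'b, 'n) module_scheme \<Rightarrow> ('a, 'c, 'o) module_scheme \<Rightarrow> ('b \<Rightarrow> 'c) set"
where
  "left_module_iso R M N =
     {h. bij_betw h (carrier M) (carrier N) \<and>
         (\<forall>x\<in>carrier M. \<forall>y\<in>carrier M. h (x \<oplus>\<^bsub>M\<^esub> y) = h x \<oplus>\<^bsub>N\<^esub> h y) \<and>
         (\<forall>r\<in>carrier R. \<forall>x\<in>carrier M. h (r \<odot>\<^bsub>M\<^esub> x) = r \<odot>\<^bsub>N\<^esub> h x)}"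

definition similar :: "('a, 'm) ring_scheme \<Rightarrow> 'a \<Rightarrow> 'a \<Rightarrow> bool" where
  "similar R A B \<longleftrightarrow> left_module_iso R (left_quotient R A) (left_quotient R B) \<noteq> {}"


subsection \<open>The \<open>b\<close>-length and the elements \<open>P\<^bsup>[\<mu>]\<^esup>\<close>\<close>

text \<open>The denominator \<open>t\<close> is unique up to sign; the sign is normalised by
  \<open>t > 0\<close>.\<close>

definition b_decomp :: "nat \<Rightarrow> rat \<Rightarrow> int \<Rightarrow> int \<Rightarrow> int \<Rightarrow> bool" where
  "b_decomp b \<mu> \<alpha> s t \<longleftrightarrow>
     t > 0 \<and> coprime s t \<and> coprime t (int b) \<and>
     \<mu> = (of_nat b powi \<alpha>) * (of_int s / of_int t)"

definition b_length :: "nat \<Rightarrow> rat \<Rightarrow> nat" where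
  "b_length b \<mu> =
     (THE l. \<exists>\<alpha> s t. b_decomp b \<mu> \<alpha> s t \<and> l = (if t = 1 then 0 else ord (nat t) b))"

lemma b_decomp_unique:
  assumes "b \<ge> 2" "b_decomp b \<mu> \<alpha> s t" "b_decomp b \<mu> \<alpha>' s' t'" "\<mu> \<noteq> 0"
  shows "t = t'"
proof -
  have dvd: "t dvd t'" if "b_decomp b \<mu> \<alpha> s t" "b_decomp b \<mu> \<alpha>' s' t'" for \<alpha> s t \<alpha>' s' t'
  proof -
    define N where "N = nat \<bar>\<alpha>\<bar> + nat \<bar>\<alpha>'\<bar>"
    have "(of_nat b :: rat) powi \<alpha> * (of_int s / of_int t) = of_nat b powi \<alpha>' * (of_int s' / of_int t')"
      using that by (simp add: b_decomp_def)
    hence "of_nat b powi (int N) * ((of_nat b :: rat) powi \<alpha> * (of_int s / of_int t)) = of_nat b powi (int N) * (of_nat b powi \<alpha>' * (of_int s' / of_int t'))"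
      by simp
    hence "((of_nat b :: rat) powi (int N + \<alpha>) * (of_int s / of_int t)) = (of_nat b powi (int N + \<alpha>') * (of_int s' / of_int t'))"
      using assms(1) by (simp add: power_int_add mult_ac)
    moreover have "int N + \<alpha> = int (nat (int N + \<alpha>))" "int N + \<alpha>' = int (nat (int N + \<alpha>'))" by (auto simp: N_def)
    ultimately have "((of_nat b :: rat) ^ (nat (int N + \<alpha>)) * (of_int s / of_int t)) = (of_nat b ^ (nat (int N + \<alpha>')) * (of_int s' / of_int t'))"
      by (metis power_int_of_nat)
    hence "(of_nat b :: rat) ^ (nat (int N + \<alpha>)) * of_int s * of_int t' = of_nat b ^ (nat (int N + \<alpha>')) * of_int s' * of_int t"
      using that by (simp add: b_decomp_def field_simps)
    hence "of_int (int b ^ (nat (int N + \<alpha>)) * s * t') = (of_int (int b ^ (nat (int N + \<alpha>')) * s' * t) :: rat)"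
      by simp
    hence "int b ^ (nat (int N + \<alpha>)) * s * t' = int b ^ (nat (int N + \<alpha>')) * s' * t"
      using of_int_eq_iff by blast
    hence "t dvd (int b ^ (nat (int N + \<alpha>)) * s) * t'" by simp
    moreover have "coprime t (int b ^ (nat (int N + \<alpha>)) * s)"
      using that by (auto simp: b_decomp_def coprime_commute)
    ultimately show ?thesis by (simp add: coprime_dvd_mult_right_iff)
  qed
  have "t > 0" "t' > 0" using assms(2,3) by (auto simp: b_decomp_def)
  thus ?thesis
    using dvd[OF assms(2,3)] dvd[OF assms(3,2)] zdvd_antisym_nonneg[of t t'] by linarith
qed

lemma b_length_eq:
  assumes "b \<ge> 2" "\<mu> \<noteq> 0" "b_decomp b \<mu> \<alpha> s t"
  shows "b_length b \<mu> = (if t = 1 then 0 else ord (nat t) b)"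
  unfolding b_length_def
proof (rule the_equality)
  show "\<exists>\<alpha> s t'. b_decomp b \<mu> \<alpha> s t' \<and>
          (if t = 1 then 0 else ord (nat t) b) = (if t' = 1 then 0 else ord (nat t') b)"
    using assms(3) by (intro exI[of _ \<alpha>] exI[of _ s] exI[of _ t] conjI refl)
next
  fix l assume "\<exists>\<alpha> s t. b_decomp b \<mu> \<alpha> s t \<and> l = (if t = 1 then 0 else ord (nat t) b)"
  then obtain \<alpha>' s' t' where *: "b_decomp b \<mu> \<alpha>' s' t'" "l = (if t' = 1 then 0 else ord (nat t') b)"
    by (elim exE conjE)
  have "t' = t" by (rule b_decomp_unique[OF assms(1) *(1) assms(3) assms(2)])
  with *(2) show "l = (if t = 1 then 0 else ord (nat t) b)" by (simp only:)
qed

lemma b_decomp_exists: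
  assumes "b \<ge> 2"
  shows "\<exists>\<alpha> s t. b_decomp b \<mu> \<alpha> s t"
proof -
  obtain n d where nd: "quotient_of \<mu> = (n, d)" by force
  have "d > 0" "coprime n d" "\<mu> = of_int n / of_int d"
    using nd quotient_of_denom_pos quotient_of_coprime quotient_of_div by blast+
  have *: "\<exists>\<alpha> s t. b_decomp b (of_int n / of_int (int e)) \<alpha> s t" if "e > 0" for n e
    using that
  proof (induction e arbitrary: n rule: less_induct)
    case (less e)
    show ?case
    proof (cases "coprime n (int e) \<and> coprime (int e) (int b)")
      case True
      hence "b_decomp b (of_int n / of_int (int e)) 0 n (int e)" using less.prems by (simp add: b_decomp_def)
      thus ?thesis by blast
    next
      case False
      show ?thesis
      proof (cases "coprime n (int e)")
        case f: False
        define g where "g = gcd n (int e)"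
        have g: "g > 1" using f less.prems
          by (smt (verit, best) coprime_iff_gcd_eq_1 g_def gcd_pos_int of_nat_0_less_iff)
        obtain n' e' where ne: "n = g * n'" "int e = g * e'" unfolding g_def by (meson dvdE gcd_dvd1 gcd_dvd2)
        have e': "e' > 0" "e' < int e" using ne g less.prems
          by (smt (verit) of_nat_0_less_iff zero_less_mult_pos mult_less_cancel_right1)+
        have "\<exists>\<alpha> s t. b_decomp b (of_int n' / of_int (int (nat e'))) \<alpha> s t"
          using less.IH[of "nat e'" n'] e' by auto
        moreover have "(of_int n' / of_int (int (nat e')) :: rat) = of_int n / of_int (int e)"
          unfolding ne using g e' by (simp add: field_simps)
        ultimately show ?thesis by metis
      next
        case t: True
        hence nc: "\<not> coprime (int e) (int b)" using False by simp
        define g where "g = gcd (int e) (int b)"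
        have g: "g > 1" using nc less.prems
          by (smt (verit, best) coprime_iff_gcd_eq_1 g_def gcd_pos_int of_nat_0_less_iff)
        obtain e' b' where ne: "int b = g * b'" "int e = g * e'" unfolding g_def by (meson dvdE gcd_dvd1 gcd_dvd2)
        have e': "e' > 0" "e' < int e" using ne g less.prems
          by (smt (verit) of_nat_0_less_iff zero_less_mult_pos mult_less_cancel_right1)+
        have "\<exists>\<alpha> s t. b_decomp b (of_int (b' * n) / of_int (int (nat e'))) \<alpha> s t"
          using less.IH[of "nat e'" "b' * n"] e' by auto
        then obtain \<alpha> s t where d: "b_decomp b (of_int (b' * n) / of_int (int (nat e'))) \<alpha> s t" by blast
        have "(of_int (b' * n) / of_int (int (nat e')) :: rat) = of_int (int b) * (of_int n / of_int (int e))"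
          unfolding ne using g e' by (simp add: field_simps)
        hence "b_decomp b (of_int n / of_int (int e)) (\<alpha> - 1) s t"
          using d assms by (auto simp: b_decomp_def power_int_diff field_simps)
        thus ?thesis by blast
      qed
    qed
  qed
  show ?thesis using *[of "nat d" n] \<open>d > 0\<close> \<open>\<mu> = _\<close> by simp
qed

text \<open>\<open>Q = P\<^bsup>[\<mu>]\<^esup> = u\<^bsup>-\<mu>\<^esup> P u\<^bsup>\<mu>\<^esup>\<close>, as an element of
  \<open>K[T, \<phi>]\<close>.  Write \<open>\<mu> = s/d\<close> in lowest terms.  The equality is read in
  \<open>k((v))[T, \<phi>]\<close> with \<open>v = u\<^bsup>1/d\<^esup>\<close>: there \<open>\<phi>\<close> is
  given by the same formula \<open>\<phi>(v\<^sup>n) = v\<^bsup>bn\<^esup>\<close>,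
  \<open>u\<^bsup>\<mu>\<^esup> = v\<^sup>s\<close>, and \<open>K\<close> embeds by
  \<open>u \<mapsto> v\<^sup>d\<close>.  In particular the relation says that the conjugate of \<open>P\<close>
  lies in \<open>K[T, \<phi>]\<close>, and \<open>Q\<close> is determined by \<open>P\<close> and
  \<open>\<mu>\<close>.\<close>

definition is_conj_power ::
  "('k::field \<Rightarrow> 'k) \<Rightarrow> nat \<Rightarrow> rat \<Rightarrow> 'k poly \<Rightarrow> 'k fls poly \<Rightarrow> bool"
where
  "is_conj_power \<sigma> b \<mu> P Q \<longleftrightarrow>
     (let (s, d) = quotient_of \<mu>;
          R = skew_poly_ring (fls_twist \<sigma> b)
      in map_poly (\<lambda>f. fls_compose_power f (nat d)) Q =
           [:fls_X_intpow (- s):] \<otimes>\<^bsub>R\<^esub> map_poly fls_const P \<otimes>\<^bsub>R\<^esub> [:fls_X_intpow s:])"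

end

theory Submission
  imports Defs
begin

text \<open>
  Give \<open>u\<^sup>n T\<^sup>i\<close> the weight \<open>n - (b\<^sup>i - 1) \<mu>\<close>.  Elements with
  nonnegative weights form a ring, and the part of weight \<open>0\<close> is a ring homomorphism to
  \<open>k[T\<^sup>l, \<sigma>\<^sup>l]\<close>.  Let \<open>A\<close> be irreducible; if its constant
  coefficient vanishes then \<open>A = aT\<close>, otherwise normalise that coefficient to \<open>1\<close>
  and let \<open>\<mu>\<close> be the slope of the first edge of the Newton polygon of the points
  \<open>(b\<^sup>i, v(a\<^sub>i))\<close>.  Then \<open>A\<close> has nonnegative weights and a nonconstant
  reduction.  Let \<open>P\<close> be an irreducible right factor of the reduction and
  \<open>Q = P\<^bsup>[\<mu>]\<^esup>\<close>.  In \<open>R/RQ\<close> the equation \<open>A X = 0\<close> has a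
  solution with leading term \<open>1\<close>, because \<open>\<phi>\<close> multiplies positive weights by
  \<open>b\<close> and successive approximation converges.  So \<open>R/RA\<close> maps nontrivially to
  \<open>R/RQ\<close>, and both modules are simple, since a factorisation of \<open>Q\<close> reduces to a
  factorisation of \<open>P\<close>.  A slope \<open>\<mu> = 0\<close> is replaced by \<open>1\<close> through
  conjugation with \<open>u\<close>.
\<close>

subsection \<open>Skew polynomials over a field\<close>

locale skew_field = skew_endo \<phi> for \<phi> :: "'a::field \<Rightarrow> 'a"
begin

abbreviation skew_times :: "'a poly \<Rightarrow> 'a poly \<Rightarrow> 'a poly" (infixl \<open>\<star>\<close> 70)
  where "X \<star> Y \<equiv> skew_mult \<phi> X Y"

lemma skew_zero [simp]: "0 \<star> Y = 0" "X \<star> 0 = 0"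
  by (simp_all add: skew_mult_def funpow_hom)

lemma skew_minus: "(- X) \<star> Y = - (X \<star> Y)" "X \<star> (- Y) = - (X \<star> Y)"
  using skew_add_left[of X "- X" Y] skew_add_right[of X Y "- Y"]
  by (simp_all add: add_eq_0_iff)

lemma skew_diff: "(X - X') \<star> Y = X \<star> Y - X' \<star> Y" "X \<star> (Y - Y') = X \<star> Y - X \<star> Y'"
  using skew_add_left[of X "- X'" Y] skew_add_right[of X Y "- Y'"]
  by (simp_all add: skew_minus)

lemma coeff_skew_mult:
  "poly.coeff (X \<star> Y) m = (\<Sum>i\<le>m. poly.coeff X i * (\<phi> ^^ i) (poly.coeff Y (m - i)))"
proof (induction X rule: poly_add_induct)
  case (1 a i)
  show ?case
  proof (induction Y rule: poly_add_induct)
    case (1 c j)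
    have "(\<Sum>i'\<le>m. poly.coeff (Polynomial.monom a i) i' * (\<phi> ^^ i') (poly.coeff (Polynomial.monom c j) (m - i')))
        = (\<Sum>i'\<le>m. if i' = i then (if j = m - i then a * (\<phi> ^^ i) c else 0) else 0)"
      by (intro sum.cong) (auto simp: funpow_hom)
    also have "\<dots> = poly.coeff (Polynomial.monom a i \<star> Polynomial.monom c j) m"
      by (auto simp: skew_mult_monom)
    finally show ?case ..
  qed (simp add: skew_add_right funpow_hom ring_distribs sum.distrib)
qed (simp add: skew_add_left ring_distribs sum.distrib)

lemma coeff_0_skew_mult [simp]:
  "poly.coeff (X \<star> Y) 0 = poly.coeff X 0 * poly.coeff Y 0"
  by (simp add: coeff_skew_mult)

lemma coeff_const_skew_mult [simp]: "poly.coeff ([:a:] \<star> Y) m = a * poly.coeff Y m"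
proof -
  have "poly.coeff ([:a:] \<star> Y) m = (\<Sum>i\<le>m. if i = 0 then a * poly.coeff Y m else 0)"
    unfolding coeff_skew_mult by (intro sum.cong) (auto simp: coeff_pCons split: nat.split)
  thus ?thesis by simp
qed

lemma coeff_skew_mult_const [simp]:
  "poly.coeff (X \<star> [:a:]) m = poly.coeff X m * (\<phi> ^^ m) a"
proof -
  have "poly.coeff (X \<star> [:a:]) m = (\<Sum>i\<le>m. if i = m then poly.coeff X m * (\<phi> ^^ m) a else 0)"
    unfolding coeff_skew_mult
    by (intro sum.cong) (auto simp: coeff_pCons funpow_hom split: nat.split)
  thus ?thesis by simp
qed

lemma funpow_eq_0_iff [simp]: "(\<phi> ^^ i) x = 0 \<longleftrightarrow> x = 0"
proof
  assume "(\<phi> ^^ i) x = 0"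
  moreover have "x \<noteq> 0 \<Longrightarrow> (\<phi> ^^ i) x * (\<phi> ^^ i) (inverse x) = 1"
    by (simp flip: funpow_hom(2) add: funpow_hom(3))
  ultimately show "x = 0" by auto
qed (simp add: funpow_hom)

lemma coeff_skew_mult_degree:
  "poly.coeff (X \<star> Y) (degree X + degree Y)
     = lead_coeff X * (\<phi> ^^ degree X) (lead_coeff Y)"
proof -
  have "poly.coeff (X \<star> Y) (degree X + degree Y)
      = (\<Sum>i\<le>degree X + degree Y. if i = degree X then lead_coeff X * (\<phi> ^^ degree X) (lead_coeff Y) else 0)"
    unfolding coeff_skew_mult
  proof (intro sum.cong refl)
    fix i assume "i \<in> {..degree X + degree Y}"
    consider "i < degree X" | "i = degree X" | "i > degree X" by linarith
    thus "poly.coeff X i * (\<phi> ^^ i) (poly.coeff Y (degree X + degree Y - i))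
        = (if i = degree X then lead_coeff X * (\<phi> ^^ degree X) (lead_coeff Y) else 0)"
      by cases (auto simp: coeff_eq_0)
  qed
  thus ?thesis by simp
qed

lemma degree_skew_mult_le: "degree (X \<star> Y) \<le> degree X + degree Y"
proof (rule degree_le, intro allI impI)
  fix m assume "degree X + degree Y < m"
  hence "i > degree X \<or> m - i > degree Y" for i by linarith
  thus "poly.coeff (X \<star> Y) m = 0"
    unfolding coeff_skew_mult by (intro sum.neutral ballI) (metis coeff_eq_0 funpow_hom(4) mult_eq_0_iff)
qed

lemma degree_skew_mult:
  assumes "X \<noteq> 0" "Y \<noteq> 0"
  shows "degree (X \<star> Y) = degree X + degree Y"
proof (rule antisym[OF degree_skew_mult_le le_degree])
  show "poly.coeff (X \<star> Y) (degree X + degree Y) \<noteq> 0"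
    unfolding coeff_skew_mult_degree using assms by simp
qed

lemma skew_mult_eq_0_iff [simp]: "X \<star> Y = 0 \<longleftrightarrow> X = 0 \<or> Y = 0"
proof (rule ccontr)
  assume *: "\<not> ?thesis"
  hence "X \<star> Y = 0" "X \<noteq> 0" "Y \<noteq> 0" by auto
  thus False using coeff_skew_mult_degree[of X Y] by simp
qed

text \<open>Division on the right only needs \<open>(\<phi> ^^ m) (lead_coeff Q)\<close> to be
  invertible, so \<open>\<phi>\<close> may fail to be surjective. The predicate \<open>R\<close> is
  carried through every cancellation; later it will hold the weight bounds.\<close>

lemma skew_division_invariant:
  assumes "Q \<noteq> 0" "R Z"
    and step: "\<And>Z m. R Z \<Longrightarrow> degree Z = m + degree Q \<Longrightarrow>
      R (Z - Polynomial.monom (lead_coeff Z / (\<phi> ^^ m) (lead_coeff Q)) m \<star> Q)"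
  obtains Y S where "Z = Y \<star> Q + S" "S = 0 \<or> degree S < degree Q" "R S"
proof -
  have "\<exists>Y S. Z = Y \<star> Q + S \<and> (S = 0 \<or> degree S < degree Q) \<and> R S"
    using \<open>R Z\<close>
  proof (induction "degree Z" arbitrary: Z rule: less_induct)
    case less
    show ?case
    proof (cases "Z = 0 \<or> degree Z < degree Q")
      case True
      thus ?thesis using less.prems by (intro exI[of _ 0] exI[of _ Z]) auto
    next
      case False
      define m where "m = degree Z - degree Q"
      define M where "M = Polynomial.monom (lead_coeff Z / (\<phi> ^^ m) (lead_coeff Q)) m"
      have degZ: "degree Z = m + degree Q" using False by (simp add: m_def)
      have nz: "lead_coeff Z / (\<phi> ^^ m) (lead_coeff Q) \<noteq> 0" using False assms by simp
      have M: "M \<noteq> 0" "degree M = m" "lead_coeff M = lead_coeff Z / (\<phi> ^^ m) (lead_coeff Q)"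
        using nz by (simp_all add: M_def degree_monom_eq monom_eq_0_iff)
      have deg: "degree (M \<star> Q) = degree Z"
        using degree_skew_mult[OF M(1) assms(1)] M degZ by simp
      have lc: "lead_coeff (M \<star> Q) = lead_coeff Z"
        using coeff_skew_mult_degree[of M Q] M degZ deg assms(1) by simp
      have R: "R (Z - M \<star> Q)" unfolding M_def by (rule step[OF less.prems degZ])
      show ?thesis
      proof (cases "degree Z = 0")
        \<comment> \<open>The zero polynomial also has degree \<open>0\<close>, so the degree cannot
          drop here; instead the difference is already \<open>0\<close>.\<close>
        case True
        have "Z - M \<star> Q = 0"
          using True deg lc by (metis degree_0_id right_minus_eq)
        with R show ?thesis by (intro exI[of _ M] exI[of _ 0]) auto
      next
        case f: False
        have "degree (Z - M \<star> Q) < degree Z"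
          using f deg lc by (smt (verit) coeff_diff degree_diff_le_max leading_coeff_0_iff max.idem
              order_le_less right_minus_eq degree_0 gr_zeroI)
        from less.hyps[OF this R] obtain Y S
          where "Z - M \<star> Q = Y \<star> Q + S" "S = 0 \<or> degree S < degree Q" "R S" by blast
        thus ?thesis
          by (intro exI[of _ "Y + M"] exI[of _ S]) (auto simp: skew_add_left algebra_simps)
      qed
    qed
  qed
  thus ?thesis using that by blast
qed

text \<open>Uniqueness of remainders. The bound is put on coefficients so that it also covers
  \<open>degree Q = 0\<close>, where the only remainder is \<open>0\<close>.\<close>

lemma skew_mult_small_degree_eq_0:
  assumes "\<And>i. i \<ge> degree Q \<Longrightarrow> poly.coeff (c \<star> Q) i = 0"
  shows "c \<star> Q = 0"
proof (rule ccontr)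
  assume nz: "c \<star> Q \<noteq> 0"
  hence "degree (c \<star> Q) = degree c + degree Q" by (intro degree_skew_mult) auto
  hence "lead_coeff (c \<star> Q) = 0" by (intro assms) simp
  with nz show False by simp
qed

text \<open>A nonzero element of least degree generates, since the remainder of right division by it
  stays in \<open>I\<close>.\<close>

lemma left_ideal_principal:
  assumes "I \<noteq> {}" and add: "\<And>x y. x \<in> I \<Longrightarrow> y \<in> I \<Longrightarrow> x + y \<in> I"
    and mult: "\<And>r x. x \<in> I \<Longrightarrow> r \<star> x \<in> I"
  shows "\<exists>G. I = range (\<lambda>c. c \<star> G)"
proof (cases "I \<subseteq> {0}")
  case True
  with assms(1) have "I = {0}" by auto
  thus ?thesis by (intro exI[of _ 0]) auto
next
  case False
  then obtain G0 where "G0 \<in> I \<and> G0 \<noteq> 0" by auto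
  from ex_has_least_nat[where P = "\<lambda>G. G \<in> I \<and> G \<noteq> 0" and m = degree, OF this]
  obtain G where G: "G \<in> I" "G \<noteq> 0"
    and min: "\<And>H. H \<in> I \<Longrightarrow> H \<noteq> 0 \<Longrightarrow> degree G \<le> degree H"
    by blast
  have "x \<in> range (\<lambda>c. c \<star> G)" if "x \<in> I" for x
  proof -
    obtain Y S where YS: "x = Y \<star> G + S" "S = 0 \<or> degree S < degree G"
      by (rule skew_division_invariant[OF G(2), of "\<lambda>_. True"]) auto
    have "x + (- Y) \<star> G \<in> I" by (intro add mult that G)
    hence "S \<in> I" using YS(1) by (simp add: skew_minus)
    with YS(2) min[of S] have "S = 0" by linarith
    thus ?thesis using YS(1) by simp
  qed
  thus ?thesis using mult[OF G(1)] by (intro exI[of _ G]) auto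
qed

section \<open>Units and irreducible elements among the skew polynomials in
  \<open>T^l\<close>\<close>

lemma skew_poly_subring_0: "skew_poly_subring \<phi> 0 = skew_poly_ring \<phi>"
  by (simp add: skew_poly_subring_def skew_poly_ring_def)

lemma skew_poly_ring_simps [simp]:
  "carrier (skew_poly_ring \<phi>) = UNIV" "x \<otimes>\<^bsub>skew_poly_ring \<phi>\<^esub> y = x \<star> y"
  "\<one>\<^bsub>skew_poly_ring \<phi>\<^esub> = 1" "\<zero>\<^bsub>skew_poly_ring \<phi>\<^esub> = 0"
  "x \<oplus>\<^bsub>skew_poly_ring \<phi>\<^esub> y = x + y"
  by (simp_all add: skew_poly_ring_def)

lemma skew_poly_subring_simps [simp]:
  "x \<otimes>\<^bsub>skew_poly_subring \<phi> l\<^esub> y = x \<star> y"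
  "\<one>\<^bsub>skew_poly_subring \<phi> l\<^esub> = 1" "\<zero>\<^bsub>skew_poly_subring \<phi> l\<^esub> = 0"
  by (simp_all add: skew_poly_subring_def)

lemma carrier_skew_poly_subring:
  "P \<in> carrier (skew_poly_subring \<phi> l) \<longleftrightarrow>
     (\<forall>i. poly.coeff P i \<noteq> 0 \<longrightarrow> (if l = 0 then 1 else l) dvd i)"
  by (simp add: skew_poly_subring_def)

lemma const_in_skew_poly_subring [simp]: "[:a:] \<in> carrier (skew_poly_subring \<phi> l)"
  unfolding carrier_skew_poly_subring by (auto simp: coeff_pCons split: nat.split)

lemma skew_mult_in_skew_poly_subring:
  assumes "P \<in> carrier (skew_poly_subring \<phi> l)" "Q \<in> carrier (skew_poly_subring \<phi> l)"
  shows "P \<star> Q \<in> carrier (skew_poly_subring \<phi> l)"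
  unfolding carrier_skew_poly_subring
proof (intro allI impI)
  fix m assume "poly.coeff (P \<star> Q) m \<noteq> 0"
  then obtain i where "i \<in> {..m}" and i: "poly.coeff P i * (\<phi> ^^ i) (poly.coeff Q (m - i)) \<noteq> 0"
    unfolding coeff_skew_mult by (rule sum.not_neutral_contains_not_neutral)
  have "(if l = 0 then 1 else l) dvd i + (m - i)"
  proof (rule dvd_add)
    have "poly.coeff P i \<noteq> 0" using i by auto
    thus "(if l = 0 then 1 else l) dvd i" using assms(1) unfolding carrier_skew_poly_subring by blast
    have "poly.coeff Q (m - i) \<noteq> 0" using i by auto
    thus "(if l = 0 then 1 else l) dvd (m - i)" using assms(2) unfolding carrier_skew_poly_subring by blast
  qed
  thus "(if l = 0 then 1 else l) dvd m" using \<open>i \<in> {..m}\<close> by simp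
qed

lemma const_skew_mult_const: "[:a:] \<star> [:c:] = [:a * c:]"
  by (rule poly_eqI) (simp add: coeff_pCons split: nat.split)

lemma Units_skew_poly_subring:
  "P \<in> Units (skew_poly_subring \<phi> l) \<longleftrightarrow> P \<noteq> 0 \<and> degree P = 0"
proof
  assume "P \<in> Units (skew_poly_subring \<phi> l)"
  then obtain Q where "P \<star> Q = 1" by (auto simp: Units_def)
  moreover from this have "P \<noteq> 0" "Q \<noteq> 0" by auto
  ultimately show "P \<noteq> 0 \<and> degree P = 0"
    using degree_skew_mult[of P Q] by simp
next
  assume *: "P \<noteq> 0 \<and> degree P = 0"
  then obtain a where "P = [:a:]" by (metis degree_eq_zeroE)
  with * have a: "P = [:a:]" "a \<noteq> 0" by auto
  have "[:inverse a:] \<star> P = 1" "P \<star> [:inverse a:] = 1"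
    using a by (simp_all add: const_skew_mult_const one_pCons)
  moreover have "[:inverse a:] \<in> carrier (skew_poly_subring \<phi> l)"
    "P \<in> carrier (skew_poly_subring \<phi> l)" using a by simp_all
  ultimately show "P \<in> Units (skew_poly_subring \<phi> l)" by (auto simp: Units_def)
qed

text \<open>Units are the nonzero constants, and the factors of a nonzero \<open>P\<close> are
  nonzero, so only degrees remain.\<close>

lemma nc_irreducible_skew_poly_subring:
  "nc_irreducible (skew_poly_subring \<phi> l) P \<longleftrightarrow>
     P \<in> carrier (skew_poly_subring \<phi> l) \<and> degree P > 0 \<and>
     (\<forall>X\<in>carrier (skew_poly_subring \<phi> l). \<forall>Y\<in>carrier (skew_poly_subring \<phi> l).
        P = X \<star> Y \<longrightarrow> degree X = 0 \<or> degree Y = 0)"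
proof (cases "P = 0")
  case False
  hence "(P = X \<star> Y \<longrightarrow> X \<noteq> 0 \<and> degree X = 0 \<or> Y \<noteq> 0 \<and> degree Y = 0)
      \<longleftrightarrow> (P = X \<star> Y \<longrightarrow> degree X = 0 \<or> degree Y = 0)" for X Y
    by auto
  thus ?thesis
    unfolding nc_irreducible_def Units_skew_poly_subring skew_poly_subring_simps using False by simp
qed (simp add: nc_irreducible_def)

lemma nc_irreducible_skew_poly_ring:
  "nc_irreducible (skew_poly_ring \<phi>) P \<longleftrightarrow>
     degree P > 0 \<and> (\<forall>X Y. P = X \<star> Y \<longrightarrow> degree X = 0 \<or> degree Y = 0)"
  using nc_irreducible_skew_poly_subring[of 0 P] by (simp add: skew_poly_subring_0)

lemma nc_irreducible_degree_1:
  assumes "P \<in> carrier (skew_poly_subring \<phi> l)" "degree P = 1"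
  shows "nc_irreducible (skew_poly_subring \<phi> l) P"
  unfolding nc_irreducible_skew_poly_subring
proof (intro conjI ballI impI)
  fix X Y assume XY: "P = X \<star> Y"
  hence "X \<noteq> 0" "Y \<noteq> 0" using assms(2) by auto
  thus "degree X = 0 \<or> degree Y = 0" using degree_skew_mult[of X Y] XY assms(2) by auto
qed (use assms in auto)

text \<open>Among the right factors of positive degree, of which \<open>P0\<close> itself is one, a
  factor of least degree has no proper factorisation.\<close>

lemma irreducible_right_factor:
  assumes "P0 \<in> carrier (skew_poly_subring \<phi> l)" "degree P0 > 0"
  obtains P1 P where "P1 \<in> carrier (skew_poly_subring \<phi> l)"
    "nc_irreducible (skew_poly_subring \<phi> l) P" "P0 = P1 \<star> P"
proof -
  let ?S = "carrier (skew_poly_subring \<phi> l)"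
  have "P0 \<in> ?S \<and> degree P0 > 0 \<and> (\<exists>P1\<in>?S. P0 = P1 \<star> P0)"
    using assms by (auto intro!: bexI[of _ "[:1:]"] poly_eqI)
  from ex_has_least_nat[where P = "\<lambda>P. P \<in> ?S \<and> degree P > 0 \<and> (\<exists>P1\<in>?S. P0 = P1 \<star> P)" and m = degree, OF this]
  obtain P P1 where P: "P \<in> ?S" "degree P > 0" "P1 \<in> ?S" "P0 = P1 \<star> P"
    and min: "\<And>P' P1. P' \<in> ?S \<Longrightarrow> degree P' > 0 \<Longrightarrow> P1 \<in> ?S \<Longrightarrow> P0 = P1 \<star> P' \<Longrightarrow> degree P \<le> degree P'"
    by blast
  have "nc_irreducible (skew_poly_subring \<phi> l) P"
    unfolding nc_irreducible_skew_poly_subring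
  proof (intro conjI ballI impI)
    fix X Y assume XY: "X \<in> ?S" "Y \<in> ?S" "P = X \<star> Y"
    hence "X \<noteq> 0" "Y \<noteq> 0" using P(2) by auto
    moreover have "degree Y > 0 \<longrightarrow> degree P \<le> degree Y"
      using min[of Y "P1 \<star> X"] XY P by (auto simp: skew_assoc skew_mult_in_skew_poly_subring)
    ultimately show "degree X = 0 \<or> degree Y = 0"
      using degree_skew_mult[of X Y] XY(3) by auto
  qed (use P in auto)
  with P that show ?thesis by blast
qed

subsection \<open>Similarity\<close>

definition left_coset :: "'a poly \<Rightarrow> 'a poly \<Rightarrow> 'a poly set" where
  "left_coset Q x = range (\<lambda>c. c \<star> Q + x)"

lemma left_coset_self [simp]: "x \<in> left_coset Q x"
  unfolding left_coset_def by (auto intro!: image_eqI[of _ _ 0])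

lemma left_coset_eq_iff: "left_coset Q x = left_coset Q y \<longleftrightarrow> x - y \<in> range (\<lambda>c. c \<star> Q)"
proof
  assume "left_coset Q x = left_coset Q y"
  hence "x \<in> left_coset Q y" by (metis left_coset_self)
  thus "x - y \<in> range (\<lambda>c. c \<star> Q)" by (auto simp: left_coset_def)
next
  assume "x - y \<in> range (\<lambda>c. c \<star> Q)"
  then obtain c where "x = c \<star> Q + y" by (auto simp: algebra_simps)
  hence "d \<star> Q + x = (d + c) \<star> Q + y" "d \<star> Q + y = (d - c) \<star> Q + x" for d
    by (simp_all add: skew_add_left skew_diff)
  hence "d \<star> Q + x \<in> left_coset Q y" "d \<star> Q + y \<in> left_coset Q x" for d
    unfolding left_coset_def by blast+
  thus "left_coset Q x = left_coset Q y" by (auto simp: left_coset_def)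
qed

lemma left_coset_eqI: "x - y = c \<star> Q \<Longrightarrow> left_coset Q x = left_coset Q y"
  unfolding left_coset_eq_iff by blast

lemma a_r_coset_PIdl: "PIdl\<^bsub>skew_poly_ring \<phi>\<^esub> Q +>\<^bsub>skew_poly_ring \<phi>\<^esub> x = left_coset Q x"
  by (simp add: a_r_coset_def' cgenideal_def left_coset_def full_SetCompr_eq UNION_singleton_eq_range image_image)

lemma left_quotient_simps:
  "carrier (left_quotient (skew_poly_ring \<phi>) Q) = range (left_coset Q)"
  "left_coset Q x \<oplus>\<^bsub>left_quotient (skew_poly_ring \<phi>) Q\<^esub> left_coset Q y = left_coset Q (x + y)"
  "r \<odot>\<^bsub>left_quotient (skew_poly_ring \<phi>) Q\<^esub> left_coset Q x = left_coset Q (r \<star> x)"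
proof -
  show "carrier (left_quotient (skew_poly_ring \<phi>) Q) = range (left_coset Q)"
    by (simp add: left_quotient_def A_RCOSETS_def' a_r_coset_PIdl UNION_singleton_eq_range)
  have "z \<in> left_coset Q (x + y) \<longleftrightarrow> z \<in> left_coset Q x <+>\<^bsub>skew_poly_ring \<phi>\<^esub> left_coset Q y" for z
  proof
    assume "z \<in> left_coset Q (x + y)"
    then obtain c where "z = (c \<star> Q + x) + (0 \<star> Q + y)" by (auto simp: left_coset_def)
    thus "z \<in> left_coset Q x <+>\<^bsub>skew_poly_ring \<phi>\<^esub> left_coset Q y"
      unfolding left_coset_def set_add_def' skew_poly_ring_simps by blast
  next
    assume "z \<in> left_coset Q x <+>\<^bsub>skew_poly_ring \<phi>\<^esub> left_coset Q y"
    then obtain c d where "z = (c \<star> Q + x) + (d \<star> Q + y)"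
      unfolding left_coset_def set_add_def' by auto
    hence "z = (c + d) \<star> Q + (x + y)" by (simp add: skew_add_left)
    thus "z \<in> left_coset Q (x + y)" unfolding left_coset_def by blast
  qed
  thus "left_coset Q x \<oplus>\<^bsub>left_quotient (skew_poly_ring \<phi>) Q\<^esub> left_coset Q y = left_coset Q (x + y)"
    by (auto simp: left_quotient_def)
  \<comment> \<open>The union in \<open>smult\<close> collapses: changing \<open>x\<close> by
    \<open>c \<star> Q\<close> changes \<open>r \<star> x\<close> by
    \<open>(r \<star> c) \<star> Q\<close>.\<close>
  have *: "left_coset Q (r \<star> x') = left_coset Q (r \<star> x)" if "x' \<in> left_coset Q x" for x'
  proof -
    from that obtain c where "x' = c \<star> Q + x" by (auto simp: left_coset_def)
    hence "r \<star> x' - r \<star> x = (r \<star> c) \<star> Q" by (simp add: skew_add_right skew_assoc)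
    thus ?thesis by (rule left_coset_eqI)
  qed
  show "r \<odot>\<^bsub>left_quotient (skew_poly_ring \<phi>) Q\<^esub> left_coset Q x = left_coset Q (r \<star> x)"
  proof -
    have "left_coset Q x \<noteq> {}" using left_coset_self by blast
    have "(\<Union>x'\<in>left_coset Q x. left_coset Q (r \<star> x')) = (\<Union>x'\<in>left_coset Q x. left_coset Q (r \<star> x))"
      by (intro SUP_cong refl *)
    also have "\<dots> = left_coset Q (r \<star> x)" using \<open>left_coset Q x \<noteq> {}\<close> by (rule cSUP_const)
    finally show ?thesis by (simp add: left_quotient_def a_r_coset_PIdl)
  qed
qed

text \<open>Right multiplication by \<open>X\<close> induces a nonzero homomorphism between simple modules.\<close>

lemma similar_if_right_mult:
  assumes A: "nc_irreducible (skew_poly_ring \<phi>) A" and Q: "nc_irreducible (skew_poly_ring \<phi>) Q"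
    and X: "A \<star> X = Y \<star> Q" "X \<notin> range (\<lambda>c. c \<star> Q)"
  shows "similar (skew_poly_ring \<phi>) A Q"
proof -
  have inverse: "\<exists>d. d \<star> C = 1" if "degree C = 0" "C \<noteq> 0" for C
    using that Units_skew_poly_subring[of C 0] by (auto simp: skew_poly_subring_0 Units_def)
  \<comment> \<open>\<open>K\<close> is the preimage in \<open>R\<close> of the kernel, a left ideal
    with generator \<open>G\<close>. It contains \<open>A\<close> but not \<open>1\<close>, so
    irreducibility of \<open>A = C \<star> G\<close> makes \<open>C\<close> a unit and
    \<open>K = RA\<close>: injectivity.\<close>
  define K where "K = {r. r \<star> X \<in> range (\<lambda>c. c \<star> Q)}"
  obtain G where G: "K = range (\<lambda>c. c \<star> G)"
  proof -
    have "0 \<star> X = 0 \<star> Q" by simp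
    hence "0 \<in> K" unfolding K_def by blast
    moreover have "x + y \<in> K" if "x \<in> K" "y \<in> K" for x y
    proof -
      from that obtain c d where "x \<star> X = c \<star> Q" "y \<star> X = d \<star> Q" by (auto simp: K_def)
      hence "(x + y) \<star> X = (c + d) \<star> Q" by (simp add: skew_add_left)
      thus ?thesis unfolding K_def by blast
    qed
    moreover have "r \<star> x \<in> K" if "x \<in> K" for r x
    proof -
      from that obtain c where "x \<star> X = c \<star> Q" by (auto simp: K_def)
      hence "(r \<star> x) \<star> X = (r \<star> c) \<star> Q" by (simp add: skew_assoc)
      thus ?thesis unfolding K_def by blast
    qed
    ultimately show ?thesis using left_ideal_principal[of K] that by blast
  qed
  have "A \<in> K" unfolding K_def using X by auto
  then obtain C where C: "A = C \<star> G" using G by auto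
  have "A \<noteq> 0" using A by (auto simp: nc_irreducible_skew_poly_ring)
  hence CG: "C \<noteq> 0" "G \<noteq> 0" using C by auto
  have "degree G \<noteq> 0"
  proof
    assume "degree G = 0"
    then obtain d where "d \<star> G = 1" using inverse CG by blast
    hence "1 \<in> K" unfolding G by (metis rangeI)
    thus False using X by (simp add: K_def skew_one_left)
  qed
  hence "degree C = 0" using A C unfolding nc_irreducible_skew_poly_ring by metis
  then obtain d where "d \<star> C = 1" using inverse CG by blast
  hence "G = d \<star> A" using C by (metis skew_assoc skew_one_left)
  hence K: "r \<in> range (\<lambda>c. c \<star> A)" if "r \<in> K" for r
    using that G by (auto simp flip: skew_assoc)

  \<comment> \<open>\<open>L\<close> is the preimage of the image. It contains \<open>Q\<close>, and
    also \<open>X\<close> outside \<open>RQ\<close>, so irreducibility of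
    \<open>Q = D \<star> H\<close> makes \<open>H\<close> a unit and \<open>L = R\<close>:
    surjectivity.\<close>
  define L where "L = {r \<star> X + c \<star> Q | r c. True}"
  obtain H where H: "L = range (\<lambda>c. c \<star> H)"
  proof -
    have "0 \<in> L" unfolding L_def by (auto intro!: exI[of _ 0])
    moreover have "x + y \<in> L" if "x \<in> L" "y \<in> L" for x y
    proof -
      from that obtain r c r' c' where "x = r \<star> X + c \<star> Q" "y = r' \<star> X + c' \<star> Q"
        by (auto simp: L_def)
      hence "x + y = (r + r') \<star> X + (c + c') \<star> Q" by (simp add: skew_add_left)
      thus ?thesis unfolding L_def by blast
    qed
    moreover have "s \<star> x \<in> L" if "x \<in> L" for s x
    proof -
      from that obtain r c where "x = r \<star> X + c \<star> Q" by (auto simp: L_def)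
      hence "s \<star> x = (s \<star> r) \<star> X + (s \<star> c) \<star> Q" by (simp add: skew_add_right skew_assoc)
      thus ?thesis unfolding L_def by blast
    qed
    ultimately show ?thesis using left_ideal_principal[of L] that by blast
  qed
  have "0 \<star> X + 1 \<star> Q \<in> L" "1 \<star> X + 0 \<star> Q \<in> L" unfolding L_def by blast+
  hence "Q \<in> L" "X \<in> L" by (simp_all add: skew_one_left)
  then obtain D where D: "Q = D \<star> H" using H by auto
  have "Q \<noteq> 0" using Q by (auto simp: nc_irreducible_skew_poly_ring)
  hence DH: "D \<noteq> 0" "H \<noteq> 0" using D by auto
  have "degree D \<noteq> 0"
  proof
    assume "degree D = 0"
    then obtain d where "d \<star> D = 1" using inverse DH by blast
    hence "H = d \<star> Q" using D by (metis skew_assoc skew_one_left)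
    thus False using X(2) \<open>X \<in> L\<close> H by (auto simp flip: skew_assoc)
  qed
  hence "degree H = 0" using Q D unfolding nc_irreducible_skew_poly_ring by metis
  then obtain d where "d \<star> H = 1" using inverse DH by blast
  hence "y \<in> L" for y unfolding H by (metis rangeI skew_assoc skew_one_right)
  hence L: "\<exists>r c. y = r \<star> X + c \<star> Q" for y unfolding L_def by auto

  \<comment> \<open>The union avoids choosing a representative; all its members coincide because
    \<open>A \<star> X\<close> lies in \<open>RQ\<close>.\<close>
  define h where "h = (\<lambda>M. \<Union>x\<in>M. left_coset Q (x \<star> X))"
  have h: "h (left_coset A a) = left_coset Q (a \<star> X)" for a
  proof -
    have *: "left_coset Q (x \<star> X) = left_coset Q (a \<star> X)" if "x \<in> left_coset A a" for x
    proof -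
      from that obtain c where "x = c \<star> A + a" by (auto simp: left_coset_def)
      hence "x \<star> X - a \<star> X = (c \<star> Y) \<star> Q" by (simp add: skew_add_left skew_assoc X)
      thus ?thesis by (rule left_coset_eqI)
    qed
    have "left_coset A a \<noteq> {}" using left_coset_self by blast
    have "h (left_coset A a) = (\<Union>x\<in>left_coset A a. left_coset Q (a \<star> X))"
      unfolding h_def by (intro SUP_cong refl *)
    also have "\<dots> = left_coset Q (a \<star> X)" using \<open>left_coset A a \<noteq> {}\<close> by (rule cSUP_const)
    finally show ?thesis .
  qed
  have "inj_on h (range (left_coset A))"
  proof (intro inj_onI, elim rangeE, clarify)
    fix x y assume "h (left_coset A x) = h (left_coset A y)"
    hence "x - y \<in> K" by (simp add: h left_coset_eq_iff K_def skew_diff)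
    thus "left_coset A x = left_coset A y" unfolding left_coset_eq_iff by (rule K)
  qed
  moreover have "h ` range (left_coset A) = range (left_coset Q)"
  proof -
    have "left_coset Q y \<in> h ` range (left_coset A)" for y
    proof -
      obtain r c where "y = r \<star> X + c \<star> Q" using L by blast
      hence "y - r \<star> X = c \<star> Q" by simp
      hence "left_coset Q y = h (left_coset A r)" unfolding h by (rule left_coset_eqI)
      thus ?thesis by blast
    qed
    thus ?thesis by (auto simp: h)
  qed
  ultimately have "h \<in> left_module_iso (skew_poly_ring \<phi>)
      (left_quotient (skew_poly_ring \<phi>) A) (left_quotient (skew_poly_ring \<phi>) Q)"
    unfolding left_module_iso_def left_quotient_simps mem_Collect_eq
  proof (intro conjI)
    assume "inj_on h (range (left_coset A))" "h ` range (left_coset A) = range (left_coset Q)"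
    thus "bij_betw h (range (left_coset A)) (range (left_coset Q))" by (simp add: bij_betw_def)
  qed (auto simp: left_quotient_simps h skew_add_left skew_assoc)
  thus ?thesis by (auto simp: similar_def)
qed

end

subsection \<open>The endomorphism of the field of Laurent series\<close>

lemma nth_fls_mult_unique:
  fixes x y :: "'k::field fls"
  assumes "\<And>n. fls_nth x n \<noteq> 0 \<Longrightarrow> fls_nth y (N - n) \<noteq> 0 \<Longrightarrow> n = a"
  shows "fls_nth (x * y) N = fls_nth x a * fls_nth y (N - a)"
proof -
  let ?f = "\<lambda>n. fls_nth x n * fls_nth y (N - n)"
  let ?I = "{fls_subdegree x..N - fls_subdegree y}"
  have "fls_nth (x * y) N = sum ?f ?I" by (rule fls_times_nth(2))
  also have "\<dots> = (\<Sum>n\<in>?I. if n = a then ?f a else 0)"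
    using assms by (intro sum.cong) auto
  also have "\<dots> = (if a \<in> ?I then ?f a else 0)" by simp
  also have "\<dots> = ?f a" by (auto simp: not_le)
  finally show ?thesis .
qed

lemma nth_fls_mult_nonzero:
  fixes x y :: "'k::field fls"
  assumes "fls_nth (x * y) N \<noteq> 0"
  obtains n where "fls_nth x n \<noteq> 0" "fls_nth y (N - n) \<noteq> 0"
proof -
  have "(\<Sum>n=fls_subdegree x..N - fls_subdegree y. fls_nth x n * fls_nth y (N - n)) \<noteq> 0"
    using assms unfolding fls_times_nth(2) .
  then obtain n where "fls_nth x n * fls_nth y (N - n) \<noteq> 0"
    by (rule sum.not_neutral_contains_not_neutral)
  thus ?thesis using that by auto
qed

text \<open>The twist is the coefficientwise map \<open>S\<close> followed by the substitution of
  \<open>u^b\<close> for \<open>u\<close>; each is a ring homomorphism.\<close>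

lemma skew_endo_fls_twist:
  fixes \<sigma> :: "'k::field \<Rightarrow> 'k"
  assumes "skew_endo \<sigma>" "b > 0"
  shows "skew_endo (fls_twist \<sigma> b)"
proof -
  interpret k: skew_endo \<sigma> by fact
  interpret k': skew_field \<sigma> by unfold_locales
  note zero = k.zero
  define S where "S = (\<lambda>f :: 'k fls. Abs_fls (\<lambda>n. \<sigma> (fls_nth f n)))"
  have S: "fls_nth (S f) n = \<sigma> (fls_nth f n)" for f n
  proof -
    have "\<forall>\<^sub>\<infinity>n::nat. \<sigma> (fls_nth f (- int n)) = 0"
      using zero by (auto intro: MOST_mono[OF MOST_fls_neg_nth_eq_0[of f]])
    thus ?thesis by (simp add: S_def)
  qed
  have S_add: "S (f + g) = S f + S g" for f g
    by (rule fls_eqI) (simp add: S k.add)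
  have sum: "\<sigma> (sum h I) = (\<Sum>i\<in>I. \<sigma> (h i))" for h :: "int \<Rightarrow> 'k" and I
    by (induction I rule: infinite_finite_induct) (auto simp: zero k.add)
  \<comment> \<open>By injectivity of \<open>\<sigma>\<close>, \<open>S\<close> preserves the order,
    so both sides of \<open>S_mult\<close> are sums over the same range.\<close>
  have S_subdegree: "fls_subdegree (S f) = fls_subdegree f" for f
  proof (cases "f = 0")
    case True
    hence "S f = 0" by (intro fls_eqI) (simp add: S zero)
    with True show ?thesis by simp
  next
    case False
    have "\<sigma> x = 0 \<longleftrightarrow> x = 0" for x using k'.funpow_eq_0_iff[of 1 x] by simp
    with False show ?thesis by (intro fls_subdegree_eqI) (simp_all add: S zero)
  qed
  have S_mult: "S (f * g) = S f * S g" for f g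
    by (rule fls_eqI) (simp add: S fls_times_nth(2) S_subdegree sum k.mult)
  have S_one: "S 1 = 1"
    by (rule fls_eqI) (simp add: S zero k.one)
  have "fls_twist \<sigma> b = (\<lambda>f. fls_compose_power (S f) b)"
    by (simp add: fun_eq_iff fls_twist_def S_def)
  thus ?thesis
    by unfold_locales (use assms(2) in \<open>simp_all add: S_add S_mult S_one\<close>)
qed

locale mahler = k: skew_field \<sigma> for \<sigma> :: "'k::field \<Rightarrow> 'k" +
  fixes b :: nat
  assumes b_ge_2: "b \<ge> 2"

sublocale mahler \<subseteq> K: skew_field "fls_twist \<sigma> b"
  using skew_endo_fls_twist[of \<sigma> b] b_ge_2 k.skew_endo_axioms
  by (simp add: skew_field_def)

context mahler
begin

abbreviation \<phi> where "\<phi> \<equiv> fls_twist \<sigma> b"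

no_notation k.skew_times (infixl \<open>\<star>\<close> 70)
notation k.skew_times (infixl \<open>\<odot>\<close> 70)
notation K.skew_times (infixl \<open>\<star>\<close> 70)

lemma nth_funpow_fls_twist:
  "fls_nth ((\<phi> ^^ i) f) n = (if int b ^ i dvd n then (\<sigma> ^^ i) (fls_nth f (n div int b ^ i)) else 0)"
proof (induction i arbitrary: n)
  case (Suc i)
  have "fls_nth ((\<phi> ^^ Suc i) f) n = (if int b dvd n then \<sigma> (fls_nth ((\<phi> ^^ i) f) (n div int b)) else 0)"
    using b_ge_2 by (simp add: fls_nth_fls_twist k.zero)
  also have "\<dots> = (if int b ^ Suc i dvd n then (\<sigma> ^^ Suc i) (fls_nth f (n div int b ^ Suc i)) else 0)"
  proof (cases "int b dvd n")
    case True
    then obtain c where "n = int b * c" by auto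
    thus ?thesis using b_ge_2 by (simp add: Suc.IH k.zero)
  next
    case False
    hence "\<not> int b ^ Suc i dvd n" using dvd_mult_left by auto
    with False show ?thesis by simp
  qed
  finally show ?case .
qed simp

lemma funpow_fls_twist_X_intpow:
  "(\<phi> ^^ i) (fls_const c * fls_X_intpow n) = fls_const ((\<sigma> ^^ i) c) * fls_X_intpow (int b ^ i * n)"
proof (rule fls_eqI)
  fix m
  show "fls_nth ((\<phi> ^^ i) (fls_const c * fls_X_intpow n)) m
      = fls_nth (fls_const ((\<sigma> ^^ i) c) * fls_X_intpow (int b ^ i * n)) m"
    using b_ge_2 by (auto simp: nth_funpow_fls_twist k.funpow_hom)
qed

lemma nth_mult_funpow_nonzero:
  assumes "fls_nth (x * (\<phi> ^^ i) y) N \<noteq> 0"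
  obtains n1 n2 where "N = n1 + int b ^ i * n2" "fls_nth x n1 \<noteq> 0" "fls_nth y n2 \<noteq> 0"
proof -
  from assms obtain n where n: "fls_nth x n \<noteq> 0" "fls_nth ((\<phi> ^^ i) y) (N - n) \<noteq> 0"
    by (rule nth_fls_mult_nonzero)
  from n(2) have "int b ^ i dvd N - n" and y: "fls_nth y ((N - n) div int b ^ i) \<noteq> 0"
    by (auto simp: nth_funpow_fls_twist k.funpow_hom split: if_splits)
  hence "N = n + int b ^ i * ((N - n) div int b ^ i)" by simp
  with n(1) y show ?thesis using that by blast
qed

subsection \<open>Weights and reduction\<close>

text \<open>\<open>u\<^bsup>-\<mu>\<^esup> T\<^sup>i u\<^bsup>\<mu>\<^esup> = u\<^bsup>level \<mu> i\<^esup> T\<^sup>i\<close>.\<close>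

definition level :: "rat \<Rightarrow> nat \<Rightarrow> rat" where
  "level \<mu> i = (of_nat b ^ i - 1) * \<mu>"

lemma level_0 [simp]: "level \<mu> 0 = 0" "level 0 i = 0"
  by (simp_all add: level_def)

lemma level_add: "level \<mu> (i + j) = level \<mu> i + of_nat b ^ i * level \<mu> j"
  by (simp add: level_def power_add algebra_simps)

lemma level_mono: "\<nu> \<le> \<mu> \<Longrightarrow> level \<nu> i \<le> level \<mu> i"
  using b_ge_2 by (auto simp: level_def intro!: mult_left_mono)

lemma level_strict_mono:
  assumes "\<nu> < \<mu>" "i > 0"
  shows "level \<nu> i < level \<mu> i"
proof -
  have "(1::rat) < of_nat b ^ i" using b_ge_2 assms(2) by (intro one_less_power) auto
  thus ?thesis using assms(1) by (simp add: level_def)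
qed

text \<open>The exponent of \<open>u\<close> that remains after conjugating \<open>u^n T^i\<close>
  to \<open>u^\<mu> (u^n T^i) u^(-\<mu>)\<close>.\<close>

definition weight :: "rat \<Rightarrow> nat \<Rightarrow> int \<Rightarrow> rat" where
  "weight \<mu> i n = of_int n - level \<mu> i"

definition weight_ge :: "rat \<Rightarrow> rat \<Rightarrow> 'k fls poly \<Rightarrow> bool" where
  "weight_ge \<mu> w Z \<longleftrightarrow> (\<forall>i n. fls_nth (poly.coeff Z i) n \<noteq> 0 \<longrightarrow> w \<le> weight \<mu> i n)"

lemma weight_geD: "weight_ge \<mu> w Z \<Longrightarrow> fls_nth (poly.coeff Z i) n \<noteq> 0 \<Longrightarrow> w \<le> weight \<mu> i n"
  by (auto simp: weight_ge_def)

text \<open>The product of \<open>u^n1 T^i\<close> and \<open>u^n2 T^j\<close> has exponent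
  \<open>n1 + b^i n2\<close>; the weight of the right factor is thus stretched by
  \<open>b^i\<close>, the source of the contraction used later.\<close>

lemma weight_add:
  "weight \<mu> (i + j) (n1 + int b ^ i * n2) = weight \<mu> i n1 + of_nat b ^ i * weight \<mu> j n2"
  by (simp add: weight_def level_add algebra_simps)

lemma weight_ge_mono: "weight_ge \<mu> w Z \<Longrightarrow> w' \<le> w \<Longrightarrow> weight_ge \<mu> w' Z"
  by (force simp: weight_ge_def)

lemma weight_ge_add: "weight_ge \<mu> w X \<Longrightarrow> weight_ge \<mu> w Y \<Longrightarrow> weight_ge \<mu> w (X + Y)"
  unfolding weight_ge_def coeff_add fls_plus_nth by (metis add_0)

lemma weight_ge_uminus [simp]: "weight_ge \<mu> w (- X) \<longleftrightarrow> weight_ge \<mu> w X"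
  by (simp add: weight_ge_def)

lemma weight_ge_diff: "weight_ge \<mu> w X \<Longrightarrow> weight_ge \<mu> w Y \<Longrightarrow> weight_ge \<mu> w (X - Y)"
  using weight_ge_add[of \<mu> w X "- Y"] by simp

lemma weight_ge_slope_mono:
  assumes "weight_ge \<mu> w Z" "\<nu> \<le> \<mu>"
  shows "weight_ge \<nu> w Z"
  unfolding weight_ge_def
proof (intro allI impI)
  fix i n assume "fls_nth (poly.coeff Z i) n \<noteq> 0"
  with assms(1) have "w \<le> weight \<mu> i n" by (rule weight_geD)
  also have "\<dots> \<le> weight \<nu> i n" using level_mono[OF assms(2), of i] by (simp add: weight_def)
  finally show "w \<le> weight \<nu> i n" .
qed

lemma nth_coeff_skew_mult_nonzero:
  assumes "fls_nth (poly.coeff (X \<star> Y) m) N \<noteq> 0"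
  obtains i j n1 n2 where "m = i + j" "N = n1 + int b ^ i * n2"
    "fls_nth (poly.coeff X i) n1 \<noteq> 0" "fls_nth (poly.coeff Y j) n2 \<noteq> 0"
proof -
  have "(\<Sum>i\<le>m. fls_nth (poly.coeff X i * (\<phi> ^^ i) (poly.coeff Y (m - i))) N) \<noteq> 0"
    using assms by (simp add: K.coeff_skew_mult fls_nth_sum)
  then obtain i where i: "i \<in> {..m}" "fls_nth (poly.coeff X i * (\<phi> ^^ i) (poly.coeff Y (m - i))) N \<noteq> 0"
    by (rule sum.not_neutral_contains_not_neutral)
  from i(2) obtain n1 n2 where "N = n1 + int b ^ i * n2"
      "fls_nth (poly.coeff X i) n1 \<noteq> 0" "fls_nth (poly.coeff Y (m - i)) n2 \<noteq> 0"
    by (rule nth_mult_funpow_nonzero)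
  thus ?thesis using i(1) that[of i "m - i"] by simp
qed

lemma weight_ge_skew_mult_left:
  assumes "weight_ge \<mu> w X" "weight_ge \<mu> 0 Y"
  shows "weight_ge \<mu> w (X \<star> Y)"
  unfolding weight_ge_def
proof (intro allI impI)
  fix m N assume "fls_nth (poly.coeff (X \<star> Y) m) N \<noteq> 0"
  then obtain i j n1 n2 where *: "m = i + j" "N = n1 + int b ^ i * n2"
    "fls_nth (poly.coeff X i) n1 \<noteq> 0" "fls_nth (poly.coeff Y j) n2 \<noteq> 0"
    by (rule nth_coeff_skew_mult_nonzero)
  have "w \<le> weight \<mu> i n1" "0 \<le> weight \<mu> j n2" using assms * by (auto dest: weight_geD)
  hence "w + 0 \<le> weight \<mu> i n1 + of_nat b ^ i * weight \<mu> j n2" by (intro add_mono) auto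
  thus "w \<le> weight \<mu> m N" by (simp add: * weight_add)
qed

text \<open>If only powers \<open>T^i\<close> with \<open>i \<ge> m0\<close> occur in
  \<open>X\<close>, the stretching factor is at least \<open>b^m0\<close>. It is applied with
  \<open>m0 = 1\<close> to \<open>A - 1\<close> and with \<open>m0 = 0\<close> to
  \<open>A\<close>.\<close>

lemma weight_ge_skew_mult_right:
  assumes "weight_ge \<mu> 0 X" "weight_ge \<mu> w Y" "w \<ge> 0"
    and "\<And>i. poly.coeff X i \<noteq> 0 \<Longrightarrow> i \<ge> m0"
  shows "weight_ge \<mu> (of_nat b ^ m0 * w) (X \<star> Y)"
  unfolding weight_ge_def
proof (intro allI impI)
  fix m N assume "fls_nth (poly.coeff (X \<star> Y) m) N \<noteq> 0"
  then obtain i j n1 n2 where *: "m = i + j" "N = n1 + int b ^ i * n2"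
    "fls_nth (poly.coeff X i) n1 \<noteq> 0" "fls_nth (poly.coeff Y j) n2 \<noteq> 0"
    by (rule nth_coeff_skew_mult_nonzero)
  have w: "0 \<le> weight \<mu> i n1" "w \<le> weight \<mu> j n2" using assms * by (auto dest: weight_geD)
  have "m0 \<le> i" using *(3) by (intro assms(4)) auto
  hence "(of_nat b ^ m0 :: rat) \<le> of_nat b ^ i" using b_ge_2 by (intro power_increasing) auto
  hence "0 + of_nat b ^ m0 * w \<le> weight \<mu> i n1 + of_nat b ^ i * weight \<mu> j n2"
    using w assms(3) by (intro add_mono mult_mono) auto
  thus "of_nat b ^ m0 * w \<le> weight \<mu> m N" by (simp add: * weight_add)
qed

text \<open>The part of weight \<open>0\<close>, i.e. the residue of
  \<open>u\<^bsup>\<mu>\<^esup> Z u\<^bsup>-\<mu>\<^esup>\<close> at \<open>u = 0\<close>.\<close>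

definition reduction :: "rat \<Rightarrow> 'k fls poly \<Rightarrow> 'k poly" where
  "reduction \<mu> Z = Abs_poly (\<lambda>i. if level \<mu> i \<in> \<int> then fls_nth (poly.coeff Z i) \<lfloor>level \<mu> i\<rfloor> else 0)"

lemma coeff_reduction:
  "poly.coeff (reduction \<mu> Z) i = (if level \<mu> i \<in> \<int> then fls_nth (poly.coeff Z i) \<lfloor>level \<mu> i\<rfloor> else 0)"
  unfolding reduction_def by (subst coeff_Abs_poly[where n = "degree Z"]) (simp_all add: coeff_eq_0)

lemma degree_reduction_le: "degree (reduction \<mu> Z) \<le> degree Z"
  by (rule degree_le) (simp add: coeff_reduction coeff_eq_0)

lemma reduction_diff: "reduction \<mu> (X - Y) = reduction \<mu> X - reduction \<mu> Y"
  by (rule poly_eqI) (simp add: coeff_reduction)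

lemma weight_eq_0_iff: "weight \<mu> i n = 0 \<longleftrightarrow> level \<mu> i \<in> \<int> \<and> n = \<lfloor>level \<mu> i\<rfloor>"
proof
  assume "weight \<mu> i n = 0"
  hence "level \<mu> i = of_int n" by (simp add: weight_def)
  thus "level \<mu> i \<in> \<int> \<and> n = \<lfloor>level \<mu> i\<rfloor>" by simp
qed (auto simp: weight_def elim: Ints_cases)

text \<open>With nonnegative weights, a product term has weight \<open>0\<close> only if both of its
  factors do. So each summand of a product coefficient receives at most one contribution at the
  exponent of weight \<open>0\<close>.\<close>

lemma reduction_skew_mult:
  assumes "weight_ge \<mu> 0 X" "weight_ge \<mu> 0 Y"
  shows "reduction \<mu> (X \<star> Y) = reduction \<mu> X \<odot> reduction \<mu> Y"
proof (rule poly_eqI)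
  fix m
  show "poly.coeff (reduction \<mu> (X \<star> Y)) m = poly.coeff (reduction \<mu> X \<odot> reduction \<mu> Y) m"
  proof (cases "level \<mu> m \<in> \<int>")
    case False
    have "poly.coeff (reduction \<mu> X) i * (\<sigma> ^^ i) (poly.coeff (reduction \<mu> Y) (m - i)) = 0" if "i \<le> m" for i
    proof (rule ccontr)
      assume "poly.coeff (reduction \<mu> X) i * (\<sigma> ^^ i) (poly.coeff (reduction \<mu> Y) (m - i)) \<noteq> 0"
      hence "level \<mu> i \<in> \<int>" "level \<mu> (m - i) \<in> \<int>"
        by (auto simp: coeff_reduction split: if_splits)
      hence "level \<mu> (i + (m - i)) \<in> \<int>" unfolding level_add
        by (intro Ints_add Ints_mult Ints_power) auto
      with False that show False by simp
    qed
    hence "poly.coeff (reduction \<mu> X \<odot> reduction \<mu> Y) m = 0"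
      unfolding k.coeff_skew_mult by (intro sum.neutral) simp
    thus ?thesis using False by (simp add: coeff_reduction)
  next
    case True
    define N where "N = \<lfloor>level \<mu> m\<rfloor>"
    have wN: "weight \<mu> m N = 0" using True by (simp add: weight_eq_0_iff N_def)
    have "fls_nth (poly.coeff X i * (\<phi> ^^ i) (poly.coeff Y (m - i))) N
        = poly.coeff (reduction \<mu> X) i * (\<sigma> ^^ i) (poly.coeff (reduction \<mu> Y) (m - i))"
      if "i \<le> m" for i
    proof -
      have *: "weight \<mu> i n1 = 0 \<and> weight \<mu> (m - i) n2 = 0"
        if "N = n1 + int b ^ i * n2" "fls_nth (poly.coeff X i) n1 \<noteq> 0"
          "fls_nth (poly.coeff Y (m - i)) n2 \<noteq> 0" for n1 n2
      proof -
        have ge: "0 \<le> weight \<mu> i n1" "0 \<le> weight \<mu> (m - i) n2"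
          using that assms by (auto dest: weight_geD)
        have "weight \<mu> i n1 + of_nat b ^ i * weight \<mu> (m - i) n2 = 0"
          using wN weight_add[of \<mu> i "m - i" n1 n2] \<open>i \<le> m\<close> that(1) by simp
        moreover have "0 \<le> of_nat b ^ i * weight \<mu> (m - i) n2" using ge by simp
        ultimately have "weight \<mu> i n1 = 0" "of_nat b ^ i * weight \<mu> (m - i) n2 = 0"
          using ge by linarith+
        thus ?thesis using b_ge_2 by simp
      qed
      show ?thesis
      proof (cases "level \<mu> i \<in> \<int> \<and> level \<mu> (m - i) \<in> \<int>")
        case t: True
        then obtain a c where a: "level \<mu> i = of_int a" and c: "level \<mu> (m - i) = of_int c"
          by (auto elim!: Ints_cases)
        have "weight \<mu> m (a + int b ^ i * c) = 0"
          using weight_add[of \<mu> i "m - i" a c] that by (simp add: weight_def a c)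
        hence N: "N = a + int b ^ i * c" by (simp add: weight_eq_0_iff N_def)
        have "fls_nth (poly.coeff X i * (\<phi> ^^ i) (poly.coeff Y (m - i))) N
            = fls_nth (poly.coeff X i) a * fls_nth ((\<phi> ^^ i) (poly.coeff Y (m - i))) (N - a)"
        proof (rule nth_fls_mult_unique)
          fix n assume n: "fls_nth (poly.coeff X i) n \<noteq> 0"
            "fls_nth ((\<phi> ^^ i) (poly.coeff Y (m - i))) (N - n) \<noteq> 0"
          hence "int b ^ i dvd N - n" "fls_nth (poly.coeff Y (m - i)) ((N - n) div int b ^ i) \<noteq> 0"
            by (auto simp: nth_funpow_fls_twist k.funpow_hom split: if_splits)
          with n(1) *[of n "(N - n) div int b ^ i"] have "weight \<mu> i n = 0" by simp
          thus "n = a" by (simp add: weight_eq_0_iff a)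
        qed
        also have "fls_nth ((\<phi> ^^ i) (poly.coeff Y (m - i))) (N - a) = (\<sigma> ^^ i) (fls_nth (poly.coeff Y (m - i)) c)"
          using b_ge_2 by (simp add: nth_funpow_fls_twist N)
        finally show ?thesis by (simp add: coeff_reduction a c)
      next
        \<comment> \<open>An integral level at \<open>m\<close> does not force integral levels at
          \<open>i\<close> and \<open>m - i\<close>; without them no pair of exponents has both
          weights \<open>0\<close>, and the summand vanishes there.\<close>
        case False
        have "fls_nth (poly.coeff X i * (\<phi> ^^ i) (poly.coeff Y (m - i))) N = 0"
        proof (rule ccontr)
          assume "fls_nth (poly.coeff X i * (\<phi> ^^ i) (poly.coeff Y (m - i))) N \<noteq> 0"
          then obtain n1 n2 where "N = n1 + int b ^ i * n2"
              "fls_nth (poly.coeff X i) n1 \<noteq> 0" "fls_nth (poly.coeff Y (m - i)) n2 \<noteq> 0"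
            by (rule nth_mult_funpow_nonzero)
          from *[OF this] False show False by (simp add: weight_eq_0_iff)
        qed
        thus ?thesis using False by (auto simp: coeff_reduction k.funpow_hom)
      qed
    qed
    thus ?thesis using True by (simp add: coeff_reduction k.coeff_skew_mult K.coeff_skew_mult fls_nth_sum flip: N_def)
  qed
qed

text \<open>If \<open>\<mu>\<close> has denominator \<open>d\<close>, all weights are multiples of
  \<open>1/d\<close>, so strictly positive weights are uniformly at least
  \<open>1/d\<close>.\<close>

lemma weight_ge_positive:
  assumes "weight_ge \<mu> 0 Z" "reduction \<mu> Z = 0"
  obtains \<delta> where "\<delta> > 0" "weight_ge \<mu> \<delta> Z"
proof -
  obtain s d where sd: "quotient_of \<mu> = (s, d)" by force
  have d: "d > 0" and \<mu>: "\<mu> = of_int s / of_int d"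
    using sd quotient_of_denom_pos quotient_of_div by blast+
  have "1 / of_int d \<le> weight \<mu> i n" if nz: "fls_nth (poly.coeff Z i) n \<noteq> 0" for i n
  proof -
    have "weight \<mu> i n \<noteq> 0"
    proof
      assume "weight \<mu> i n = 0"
      hence "poly.coeff (reduction \<mu> Z) i \<noteq> 0" using nz by (auto simp: weight_eq_0_iff coeff_reduction)
      thus False using assms(2) by simp
    qed
    hence "weight \<mu> i n > 0" using weight_geD[OF assms(1) nz] by simp
    moreover have eq: "of_int d * weight \<mu> i n = of_int (d * n - (int b ^ i - 1) * s)"
      using d by (simp add: weight_def level_def \<mu> field_simps)
    ultimately have "(0::rat) < of_int (d * n - (int b ^ i - 1) * s)"
      using d by (metis mult_pos_pos of_int_0_less_iff)
    hence "(1::rat) \<le> of_int (d * n - (int b ^ i - 1) * s)"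
      unfolding of_int_0_less_iff of_int_1_le_iff by simp
    also have "\<dots> = of_int d * weight \<mu> i n" by (rule eq[symmetric])
    finally show ?thesis using d by (simp add: field_simps)
  qed
  thus ?thesis using d by (intro that[of "1 / of_int d"]) (auto simp: weight_ge_def)
qed

text \<open>\<open>conj_power \<mu> P\<close> is \<open>P\<^bsup>[\<mu>]\<^esup>\<close> provided that the
  exponents \<open>i\<close> of \<open>P\<close> satisfy \<open>(b\<^sup>i - 1) \<mu> \<in> \<int>\<close>.\<close>

definition conj_power :: "rat \<Rightarrow> 'k poly \<Rightarrow> 'k fls poly" where
  "conj_power \<mu> P = Abs_poly (\<lambda>i. if level \<mu> i \<in> \<int>
     then fls_const (poly.coeff P i) * fls_X_intpow \<lfloor>level \<mu> i\<rfloor> else 0)"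

lemma coeff_conj_power:
  "poly.coeff (conj_power \<mu> P) i = (if level \<mu> i \<in> \<int>
     then fls_const (poly.coeff P i) * fls_X_intpow \<lfloor>level \<mu> i\<rfloor> else 0)"
  unfolding conj_power_def by (subst coeff_Abs_poly[where n = "degree P"]) (simp_all add: coeff_eq_0)

lemma weight_ge_conj_power: "weight_ge \<mu> 0 (conj_power \<mu> P)"
  unfolding weight_ge_def
proof (intro allI impI)
  fix i n assume "fls_nth (poly.coeff (conj_power \<mu> P) i) n \<noteq> 0"
  hence "weight \<mu> i n = 0"
    unfolding weight_eq_0_iff by (auto simp: coeff_conj_power split: if_splits)
  thus "0 \<le> weight \<mu> i n" by simp
qed

text \<open>Admissibility of exponents expressed by \<open>\<mu>\<close> instead of its
  \<open>b\<close>-length, so that \<open>\<mu> = 0\<close> is allowed;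
  \<open>b_length_dvd_iff\<close> translates.\<close>

definition level_poly :: "rat \<Rightarrow> 'k poly \<Rightarrow> bool" where
  "level_poly \<mu> P \<longleftrightarrow> (\<forall>i. poly.coeff P i \<noteq> 0 \<longrightarrow> level \<mu> i \<in> \<int>)"

lemma level_poly_reduction: "level_poly \<mu> (reduction \<mu> Z)"
  by (simp add: level_poly_def coeff_reduction)

lemma reduction_conj_power: "level_poly \<mu> P \<Longrightarrow> reduction \<mu> (conj_power \<mu> P) = P"
  by (rule poly_eqI) (auto simp: coeff_reduction coeff_conj_power level_poly_def)

lemma degree_conj_power:
  assumes "level_poly \<mu> P"
  shows "degree (conj_power \<mu> P) = degree P"
proof (rule antisym)
  show "degree (conj_power \<mu> P) \<le> degree P"
    by (rule degree_le) (simp add: coeff_conj_power coeff_eq_0)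
  show "degree P \<le> degree (conj_power \<mu> P)"
    using degree_reduction_le[of \<mu> "conj_power \<mu> P"] reduction_conj_power[OF assms] by simp
qed

subsection \<open>Newton slopes\<close>

text \<open>The slope of the first edge of the Newton polygon of the points
  \<open>(b\<^sup>i, v(z\<^sub>i))\<close>.\<close>

lemma exists_slope:
  assumes "degree Z > 0" "poly.coeff Z 0 = fls_const c"
  obtains \<mu> where "weight_ge \<mu> 0 Z" "degree (reduction \<mu> Z) > 0"
proof -
  let ?I = "{i. 0 < i \<and> i \<le> degree Z \<and> poly.coeff Z i \<noteq> 0}"
  \<comment> \<open>\<open>q i\<close> is the slope that gives weight \<open>0\<close> to the lowest
    term of the coefficient of \<open>T^i\<close>.\<close>
  define q where "q = (\<lambda>i. of_int (fls_subdegree (poly.coeff Z i)) / (of_nat b ^ i - 1) :: rat)"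
  have pos: "(0::rat) < of_nat b ^ i - 1" if "i > 0" for i
    using that b_ge_2 by (simp add: one_less_power)
  have fin: "finite (q ` ?I)" by simp
  have "degree Z \<in> ?I" using assms(1) by auto
  hence ne: "q ` ?I \<noteq> {}" by blast
  define \<mu> where "\<mu> = Min (q ` ?I)"
  have "weight_ge \<mu> 0 Z"
    unfolding weight_ge_def
  proof (intro allI impI)
    fix i n assume nz: "fls_nth (poly.coeff Z i) n \<noteq> 0"
    show "0 \<le> weight \<mu> i n"
    proof (cases "i = 0")
      \<comment> \<open>The constant coefficient lies in \<open>k\<close>, so only
        \<open>n = 0\<close> occurs, with weight \<open>0\<close> for every slope.\<close>
      case True
      thus ?thesis using nz assms(2) by (auto simp: weight_def split: if_splits)
    next
      case False
      have "poly.coeff Z i \<noteq> 0" using nz by auto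
      hence "i \<in> ?I" using False le_degree by auto
      hence "\<mu> \<le> q i" unfolding \<mu>_def using fin by (intro Min_le) auto
      hence "level \<mu> i \<le> of_int (fls_subdegree (poly.coeff Z i))"
        using pos[of i] False by (simp add: q_def level_def field_simps)
      also have "\<dots> \<le> of_int n" using fls_subdegree_leI[OF nz] by simp
      finally show ?thesis by (simp add: weight_def)
    qed
  qed
  moreover have "degree (reduction \<mu> Z) > 0"
  proof -
    have "\<mu> \<in> q ` ?I" unfolding \<mu>_def using fin ne by (rule Min_in)
    then obtain i where i: "i \<in> ?I" "\<mu> = q i" by auto
    hence "level \<mu> i = of_int (fls_subdegree (poly.coeff Z i))"
      using pos[of i] by (simp add: q_def level_def)
    hence "poly.coeff (reduction \<mu> Z) i \<noteq> 0" using i by (simp add: coeff_reduction)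
    thus ?thesis using i le_degree by force
  qed
  ultimately show ?thesis by (rule that)
qed

text \<open>Lowering the slope strictly increases every weight with \<open>i > 0\<close>, so nothing
  but the constant term can survive in weight \<open>0\<close>.\<close>

lemma degree_reduction_smaller_slope:
  assumes "weight_ge \<mu> 0 Z" "\<nu> < \<mu>"
  shows "degree (reduction \<nu> Z) = 0"
proof -
  have "poly.coeff (reduction \<nu> Z) i = 0" if "i > 0" for i
  proof (rule ccontr)
    assume "poly.coeff (reduction \<nu> Z) i \<noteq> 0"
    hence *: "level \<nu> i \<in> \<int>" "fls_nth (poly.coeff Z i) \<lfloor>level \<nu> i\<rfloor> \<noteq> 0"
      by (auto simp: coeff_reduction split: if_splits)
    from weight_geD[OF assms(1) *(2)] have "level \<mu> i \<le> of_int \<lfloor>level \<nu> i\<rfloor>"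
      by (simp add: weight_def)
    thus False using level_strict_mono[OF assms(2) that] of_int_floor_le[of "level \<nu> i"] by linarith
  qed
  thus ?thesis using degree_le[of 0] by blast
qed

text \<open>Both factors of a factorisation of \<open>P\<^bsup>[\<mu>]\<^esup>\<close> have first slope at
  least \<open>\<mu>\<close>, so that the factorisation reduces to one of \<open>P\<close>.\<close>

lemma irreducible_conj_power:
  assumes P: "nc_irreducible (skew_poly_subring \<sigma> l) P" "poly.coeff P 0 \<noteq> 0"
    and l: "\<And>i. (if l = 0 then 1 else l) dvd i \<longleftrightarrow> level \<mu> i \<in> \<int>"
  shows "nc_irreducible (skew_poly_ring \<phi>) (conj_power \<mu> P)"
  unfolding K.nc_irreducible_skew_poly_ring
proof (intro conjI allI impI)
  have carrier: "X \<in> carrier (skew_poly_subring \<sigma> l) \<longleftrightarrow> level_poly \<mu> X" for X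
    by (simp only: k.carrier_skew_poly_subring l level_poly_def)
  have P': "level_poly \<mu> P" "degree P > 0"
    using P carrier by (auto simp: k.nc_irreducible_skew_poly_subring)
  show "degree (conj_power \<mu> P) > 0" using P' by (simp add: degree_conj_power)
  fix X Y assume XY: "conj_power \<mu> P = X \<star> Y"
  show "degree X = 0 \<or> degree Y = 0"
  proof (rule ccontr)
    assume "\<not> ?thesis"
    hence deg: "degree X > 0" "degree Y > 0" by auto
    hence nz: "X \<noteq> 0" "Y \<noteq> 0" by auto
    define c where "c = poly.coeff P 0"
    define g where "g = poly.coeff Y 0"
    have "poly.coeff (X \<star> Y) 0 = fls_const c"
      unfolding XY[symmetric] by (simp add: coeff_conj_power c_def)
    hence c: "poly.coeff X 0 * g = fls_const c" "c \<noteq> 0" using P(2) by (simp_all add: g_def c_def)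
    hence g: "g \<noteq> 0" by auto
    \<comment> \<open>Moving the constant coefficient of \<open>Y\<close> across the product puts
      both constant coefficients into \<open>k\<close> minus \<open>0\<close>:
      \<open>exists_slope\<close> applies, and the reductions cannot vanish.\<close>
    define X' Y' where "X' = X \<star> [:g:]" and "Y' = [:inverse g:] \<star> Y"
    have XY': "conj_power \<mu> P = X' \<star> Y'"
    proof -
      have "X' \<star> Y' = X \<star> (([:g:] \<star> [:inverse g:]) \<star> Y)" by (simp add: X'_def Y'_def K.skew_assoc)
      also have "[:g:] \<star> [:inverse g:] = 1" using g by (simp add: K.const_skew_mult_const one_pCons)
      finally show ?thesis by (simp add: XY K.skew_one_left)
    qed
    have 0: "poly.coeff X' 0 = fls_const c" "poly.coeff Y' 0 = fls_const 1"
      using c g by (simp_all add: X'_def Y'_def) (simp add: g_def)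
    have deg': "degree X' = degree X" "degree Y' = degree Y"
      using nz K.degree_skew_mult[of X "[:g:]"] K.degree_skew_mult[of "[:inverse g:]" Y] g deg
      by (auto simp: X'_def Y'_def)
    obtain \<mu>X where X: "weight_ge \<mu>X 0 X'" "degree (reduction \<mu>X X') > 0"
      using exists_slope 0 deg deg' by metis
    obtain \<mu>Y where Y: "weight_ge \<mu>Y 0 Y'" "degree (reduction \<mu>Y Y') > 0"
      using exists_slope 0 deg deg' by metis
    have red: "reduction \<nu> (X' \<star> Y') = reduction \<nu> X' \<odot> reduction \<nu> Y'"
        "reduction \<nu> X' \<noteq> 0" "reduction \<nu> Y' \<noteq> 0"
        "degree (reduction \<nu> X' \<odot> reduction \<nu> Y') = degree (reduction \<nu> X') + degree (reduction \<nu> Y')"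
      if "\<nu> \<le> \<mu>X" "\<nu> \<le> \<mu>Y" for \<nu>
    proof -
      show "reduction \<nu> (X' \<star> Y') = reduction \<nu> X' \<odot> reduction \<nu> Y'"
        by (intro reduction_skew_mult weight_ge_slope_mono[OF X(1)] weight_ge_slope_mono[OF Y(1)] that)
      have "poly.coeff (reduction \<nu> X') 0 \<noteq> 0" "poly.coeff (reduction \<nu> Y') 0 \<noteq> 0"
        using 0 c by (simp_all add: coeff_reduction)
      thus nz: "reduction \<nu> X' \<noteq> 0" "reduction \<nu> Y' \<noteq> 0" by auto
      show "degree (reduction \<nu> X' \<odot> reduction \<nu> Y') = degree (reduction \<nu> X') + degree (reduction \<nu> Y')"
        by (rule k.degree_skew_mult[OF nz])
    qed
    \<comment> \<open>At the smaller of the two slopes one factor has a nonconstant reduction and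
      the other a nonzero one, so the product reduces to a nonconstant polynomial; this rules out
      \<open>\<nu> < \<mu>\<close>.\<close>
    define \<nu> where "\<nu> = min \<mu>X \<mu>Y"
    have "degree (reduction \<nu> X') > 0 \<or> degree (reduction \<nu> Y') > 0"
      using X Y by (auto simp: \<nu>_def min_def)
    hence "degree (reduction \<nu> (conj_power \<mu> P)) > 0"
      unfolding XY' using red[of \<nu>] by (auto simp: \<nu>_def)
    hence "\<mu> \<le> \<nu>"
      using degree_reduction_smaller_slope[OF weight_ge_conj_power, of \<nu> \<mu> P] by force
    hence le: "\<mu> \<le> \<mu>X" "\<mu> \<le> \<mu>Y" by (simp_all add: \<nu>_def)
    have PXY: "P = reduction \<mu> X' \<odot> reduction \<mu> Y'"
      using red(1)[OF le] reduction_conj_power[OF P'(1)] XY' by simp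
    have "reduction \<mu> Z \<in> carrier (skew_poly_subring \<sigma> l)" for Z
      unfolding carrier by (rule level_poly_reduction)
    hence "degree (reduction \<mu> X') = 0 \<or> degree (reduction \<mu> Y') = 0"
      using P(1) PXY unfolding k.nc_irreducible_skew_poly_subring by metis
    \<comment> \<open>Reduction keeps the total degree and cannot raise the degree of either factor,
      so it keeps both; a factor with constant reduction would itself be constant.\<close>
    moreover have "degree (reduction \<mu> X') + degree (reduction \<mu> Y') = degree X' + degree Y'"
    proof -
      have "X' \<noteq> 0" "Y' \<noteq> 0" using deg deg' by auto
      hence "degree (conj_power \<mu> P) = degree X' + degree Y'" unfolding XY' by (rule K.degree_skew_mult)
      thus ?thesis using red(4)[OF le] PXY degree_conj_power[OF P'(1)] by simp
    qed
    ultimately show False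
      using degree_reduction_le[of \<mu> X'] degree_reduction_le[of \<mu> Y'] deg deg' by linarith
  qed
qed

section \<open>The explicit conjugates as values of \<open>P^[\<mu>]\<close>, and the
  \<open>b\<close>-length as the period of integral levels\<close>

lemma is_conj_power_conj_power:
  assumes "level_poly \<mu> P"
  shows "is_conj_power \<sigma> b \<mu> P (conj_power \<mu> P)"
proof -
  obtain s d where sd: "quotient_of \<mu> = (s, d)" by force
  have d: "d > 0" and \<mu>: "\<mu> = of_int s / of_int d"
    using sd quotient_of_denom_pos quotient_of_div by blast+
  have "map_poly (\<lambda>f. fls_compose_power f (nat d)) (conj_power \<mu> P) =
          [:fls_X_intpow (- s):] \<star> map_poly fls_const P \<star> [:fls_X_intpow s:]"
  proof (rule poly_eqI)
    fix i
    have X: "(\<phi> ^^ i) (fls_X_intpow s) = fls_X_intpow (int b ^ i * s)"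
      using funpow_fls_twist_X_intpow[of i 1 s] by (simp add: k.funpow_hom)
    have rhs: "poly.coeff ([:fls_X_intpow (- s):] \<star> map_poly fls_const P \<star> [:fls_X_intpow s:]) i
        = fls_X_intpow (- s) * fls_const (poly.coeff P i) * fls_X_intpow (int b ^ i * s)"
      by (simp add: coeff_map_poly X)
    show "poly.coeff (map_poly (\<lambda>f. fls_compose_power f (nat d)) (conj_power \<mu> P)) i
        = poly.coeff ([:fls_X_intpow (- s):] \<star> map_poly fls_const P \<star> [:fls_X_intpow s:]) i"
    proof (cases "poly.coeff P i = 0")
      case True
      thus ?thesis by (simp add: rhs) (simp add: coeff_map_poly coeff_conj_power)
    next
      case False
      with assms obtain n where n: "level \<mu> i = of_int n" by (auto simp: level_poly_def elim: Ints_cases)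
      \<comment> \<open>In \<open>v = u^(1/d)\<close> the monomial \<open>u^n\<close> with
        \<open>n = level \<mu> i\<close> becomes \<open>v^(dn)\<close>, and
        \<open>dn = b^i s - s\<close> is the exponent produced by the conjugation.\<close>
      hence "of_int ((int b ^ i - 1) * s) = (of_int (d * n) :: rat)"
        using d by (simp add: level_def \<mu> field_simps)
      hence "(int b ^ i - 1) * s = d * n" by (rule of_int_eq_iff[THEN iffD1])
      hence dn: "d * n = - s + int b ^ i * s" by (simp add: algebra_simps)
      have "poly.coeff (map_poly (\<lambda>f. fls_compose_power f (nat d)) (conj_power \<mu> P)) i
          = fls_const (poly.coeff P i) * fls_X_intpow (d * n)"
        using d n by (simp add: coeff_map_poly coeff_conj_power)
      also have "\<dots> = fls_const (poly.coeff P i) * (fls_X_intpow (- s) * fls_X_intpow (int b ^ i * s))"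
        unfolding dn by (simp only: fls_X_intpow_times_fls_X_intpow)
      finally show ?thesis unfolding rhs by (simp only: mult_ac)
    qed
  qed
  thus ?thesis by (simp add: is_conj_power_def sd)
qed

text \<open>For \<open>\<mu> = s/d\<close> in lowest terms the level at \<open>i\<close> is integral
  iff \<open>d\<close> divides \<open>b^i - 1\<close>, that is, iff the order of \<open>b\<close>
  modulo \<open>d\<close> divides \<open>i\<close>. For \<open>d = 1\<close> this order is
  \<open>1\<close>, which the marker \<open>0\<close> encodes.\<close>

lemma b_length_dvd_iff:
  assumes "\<mu> \<noteq> 0" "level \<mu> j \<in> \<int>" "j > 0"
  shows "(if b_length b \<mu> = 0 then 1 else b_length b \<mu>) dvd i \<longleftrightarrow> level \<mu> i \<in> \<int>"
proof -
  obtain s d where sd: "quotient_of \<mu> = (s, d)" by force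
  have d: "d > 0" and \<mu>: "\<mu> = of_int s / of_int d" and cop: "coprime s d"
    using sd quotient_of_denom_pos quotient_of_div quotient_of_coprime by blast+
  have iff: "level \<mu> i \<in> \<int> \<longleftrightarrow> d dvd int b ^ i - 1" for i
  proof -
    have "level \<mu> i = of_int ((int b ^ i - 1) * s) / of_int d" by (simp add: level_def \<mu>)
    hence "level \<mu> i \<in> \<int> \<longleftrightarrow> d dvd (int b ^ i - 1) * s"
      using d by (simp only: of_int_div_of_int_in_Ints_iff) simp
    also have "\<dots> \<longleftrightarrow> d dvd int b ^ i - 1"
      using cop by (simp add: coprime_commute coprime_dvd_mult_left_iff)
    finally show ?thesis .
  qed
  have iff': "level \<mu> i \<in> \<int> \<longleftrightarrow> ord (nat d) b dvd i" for i
  proof -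
    have "d dvd int b ^ i - 1 \<longleftrightarrow> [int (b ^ i) = int 1] (mod int (nat d))"
      using d by (simp add: cong_iff_dvd_diff)
    also have "\<dots> \<longleftrightarrow> ord (nat d) b dvd i" by (simp only: cong_int_iff ord_divides)
    finally show ?thesis using iff by simp
  qed
  \<comment> \<open>An order \<open>0\<close> would mean that \<open>b\<close> is not invertible
    modulo \<open>d\<close>; the positive \<open>j\<close> excludes this, so \<open>s\<close> and
    \<open>d\<close> already form a \<open>b_decomp\<close> with exponent \<open>0\<close>.\<close>
  have ord: "ord (nat d) b \<noteq> 0" using iff'[of j] assms by auto
  hence "coprime (nat d) b" using ord_eq_0[of "nat d" b] by simp
  hence "coprime d (int b)" using d by (metis coprime_int_iff int_nat_eq order_less_imp_le)
  hence "b_decomp b \<mu> 0 s d" using d cop \<mu> by (simp add: b_decomp_def)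
  hence "b_length b \<mu> = (if d = 1 then 0 else ord (nat d) b)"
    by (rule b_length_eq[OF b_ge_2 assms(1)])
  thus ?thesis unfolding iff' using ord by (cases "d = 1") (simp_all only: if_True if_False, simp_all)
qed

subsection \<open>Successive approximation\<close>

text \<open>The leading term of the divisor has weight \<open>0\<close>, so cancelling with it never
  lowers a weight bound. A single remainder satisfies the bounds for all \<open>w\<close> at
  once.\<close>

lemma weight_division:
  assumes "level_poly \<mu> P" "P \<noteq> 0"
  shows "\<exists>Y S. Z = Y \<star> conj_power \<mu> P + S \<and> (\<forall>i\<ge>degree P. poly.coeff S i = 0) \<and>
    (\<forall>w. weight_ge \<mu> w Z \<longrightarrow> weight_ge \<mu> w S)"
proof -
  let ?Q = "conj_power \<mu> P"
  have deg: "degree ?Q = degree P" by (rule degree_conj_power[OF assms(1)])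
  have Q: "?Q \<noteq> 0"
  proof
    assume "?Q = 0"
    hence "P = reduction \<mu> 0" using reduction_conj_power[OF assms(1)] by simp
    also have "\<dots> = 0" by (rule poly_eqI) (simp add: coeff_reduction)
    finally show False using assms(2) by contradiction
  qed
  define c where "c = lead_coeff P"
  have "c \<noteq> 0" using assms(2) by (simp add: c_def)
  hence "level \<mu> (degree P) \<in> \<int>" using assms(1) unfolding level_poly_def c_def by blast
  then obtain e where e: "level \<mu> (degree P) = of_int e" by (elim Ints_cases)
  hence lc: "lead_coeff ?Q = fls_const c * fls_X_intpow e"
    by (simp add: deg coeff_conj_power c_def)
  show ?thesis
  proof (rule K.skew_division_invariant[OF Q, of "\<lambda>Z'. \<forall>w. weight_ge \<mu> w Z \<longrightarrow> weight_ge \<mu> w Z'" Z])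
    fix Z' m assume Z': "\<forall>w. weight_ge \<mu> w Z \<longrightarrow> weight_ge \<mu> w Z'" "degree Z' = m + degree ?Q"
    define k where "k = int b ^ m * e"
    define d where "d = (\<sigma> ^^ m) c"
    define y where "y = lead_coeff Z' / (\<phi> ^^ m) (lead_coeff ?Q)"
    have d: "d \<noteq> 0" using \<open>c \<noteq> 0\<close> by (simp add: d_def)
    have "(\<phi> ^^ m) (lead_coeff ?Q) = fls_const d * fls_X_intpow k"
      unfolding lc funpow_fls_twist_X_intpow by (simp add: k_def d_def)
    hence "lead_coeff Z' = y * (fls_const d * fls_X_intpow k)"
      using d by (simp add: y_def)
    \<comment> \<open>Since the leading coefficient of the divisor is a monomial, dividing by its
      twist only shifts exponents by \<open>k\<close>, up to the scalar \<open>d\<close>.\<close>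
    hence nth: "fls_nth (lead_coeff Z') (n + k) = d * fls_nth y n" for n
      by (simp only:, subst nth_fls_mult_unique[where a = n]) (auto split: if_splits)
    show "\<forall>w. weight_ge \<mu> w Z \<longrightarrow> weight_ge \<mu> w (Z' - Polynomial.monom (lead_coeff Z' / (\<phi> ^^ m) (lead_coeff ?Q)) m \<star> ?Q)"
    proof (intro allI impI)
      fix w assume "weight_ge \<mu> w Z"
      hence w: "weight_ge \<mu> w Z'" using Z' by blast
      have "weight_ge \<mu> w (Polynomial.monom y m)"
        unfolding weight_ge_def
      proof (intro allI impI)
        fix i n assume "fls_nth (poly.coeff (Polynomial.monom y m) i) n \<noteq> 0"
        hence i: "i = m" "fls_nth y n \<noteq> 0" by (auto split: if_splits)
        hence "fls_nth (lead_coeff Z') (n + k) \<noteq> 0" using d by (simp add: nth)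
        hence "w \<le> weight \<mu> (m + degree P) (n + int b ^ m * e)"
          using weight_geD[OF w] Z'(2) by (simp add: deg k_def)
        also have "\<dots> = weight \<mu> m n + of_nat b ^ m * weight \<mu> (degree P) e" by (rule weight_add)
        finally show "w \<le> weight \<mu> i n" using i by (simp add: weight_def e)
      qed
      hence "weight_ge \<mu> w (Polynomial.monom y m \<star> ?Q)"
        by (rule weight_ge_skew_mult_left) (rule weight_ge_conj_power)
      with w show "weight_ge \<mu> w (Z' - Polynomial.monom (lead_coeff Z' / (\<phi> ^^ m) (lead_coeff ?Q)) m \<star> ?Q)"
        unfolding y_def by (rule weight_ge_diff)
    qed
  next
    fix Y S assume *: "Z = Y \<star> ?Q + S" "S = 0 \<or> degree S < degree ?Q"
      "\<forall>w. weight_ge \<mu> w Z \<longrightarrow> weight_ge \<mu> w S"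
    have "\<forall>i\<ge>degree P. poly.coeff S i = 0" using *(2) deg by (auto simp: coeff_eq_0)
    with * show ?thesis by blast
  qed simp
qed

text \<open>At a fixed monomial \<open>u^n T^i\<close> only finitely many \<open>E t\<close>
  contribute, because their weights tend to infinity; the bound \<open>r\<close> keeps the sum
  polynomial in \<open>T\<close>.\<close>

lemma weight_series_converges:
  assumes \<delta>: "\<delta> > 0" and E: "\<And>t. weight_ge \<mu> (of_nat (Suc t) * \<delta>) (E t)"
    and r: "\<And>t i. i \<ge> r \<Longrightarrow> poly.coeff (E t) i = 0"
  obtains X where "\<And>i. i \<ge> r \<Longrightarrow> poly.coeff X i = 0"
    "\<And>s. weight_ge \<mu> (of_nat (Suc s) * \<delta>) (X - (\<Sum>t<s. E t))"
proof -
  \<comment> \<open>From the index \<open>\<tau> i n\<close> on, every \<open>E t\<close> vanishes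
    at \<open>u^n T^i\<close>.\<close>
  define \<tau> where "\<tau> = (\<lambda>i n. nat \<lceil>weight \<mu> i n / \<delta>\<rceil>)"
  define x where "x = (\<lambda>i. Abs_fls (\<lambda>n. \<Sum>t<\<tau> i n. fls_nth (poly.coeff (E t) i) n))"
  have E0: "fls_nth (poly.coeff (E t) i) n = 0" if "weight \<mu> i n < of_nat (Suc t) * \<delta>" for t i n
    using weight_geD[OF E[of t]] that by (metis not_le)
  have nth: "fls_nth (x i) n = (\<Sum>t<\<tau> i n. fls_nth (poly.coeff (E t) i) n)" for i n
    unfolding x_def
  \<comment> \<open>Below the level all weights are negative, which bounds the order of the sum from
    below and makes it a Laurent series.\<close>
  proof (rule nth_Abs_fls_lower_bound[of "\<lfloor>level \<mu> i\<rfloor>"], intro allI impI sum.neutral ballI)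
    fix n t assume "n < \<lfloor>level \<mu> i\<rfloor>"
    hence "weight \<mu> i n < 0" unfolding weight_def by linarith
    also have "0 < of_nat (Suc t) * \<delta>" using \<delta> by simp
    finally show "fls_nth (poly.coeff (E t) i) n = 0" by (rule E0)
  qed
  have partial: "fls_nth (x i) n = (\<Sum>t<s. fls_nth (poly.coeff (E t) i) n)"
    if "weight \<mu> i n < of_nat (Suc s) * \<delta>" for i n s
  proof -
    \<comment> \<open>Terms past either cutoff vanish, so truncating at \<open>s\<close> or at
      \<open>\<tau> i n\<close> gives the same sum.\<close>
    have "fls_nth (poly.coeff (E t) i) n = 0" if "t \<ge> min s (\<tau> i n)" for t
    proof (rule E0)
      consider "t \<ge> s" | "t \<ge> \<tau> i n" using \<open>t \<ge> min s (\<tau> i n)\<close> by linarith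
      thus "weight \<mu> i n < of_nat (Suc t) * \<delta>"
      proof cases
        case 1
        have "weight \<mu> i n < of_nat (Suc s) * \<delta>" by fact
        also have "\<dots> \<le> of_nat (Suc t) * \<delta>" using 1 \<delta> by (intro mult_right_mono) auto
        finally show ?thesis .
      next
        case 2
        hence "weight \<mu> i n / \<delta> \<le> of_nat t" by (simp add: \<tau>_def nat_le_iff ceiling_le_iff)
        hence "weight \<mu> i n \<le> of_nat t * \<delta>" using \<delta> by (simp add: field_simps)
        thus ?thesis using \<delta> by (simp add: algebra_simps)
      qed
    qed
    hence "(\<Sum>t<M. fls_nth (poly.coeff (E t) i) n) = (\<Sum>t<min s (\<tau> i n). fls_nth (poly.coeff (E t) i) n)"
      if "M \<ge> min s (\<tau> i n)" for M
      using that by (intro sum.mono_neutral_right) auto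
    from this[of s] this[of "\<tau> i n"] show ?thesis by (simp add: nth)
  qed
  have xr: "x i = 0" if "i \<ge> r" for i
    by (rule fls_eqI) (simp add: nth r that)
  define X where "X = Abs_poly x"
  have X: "poly.coeff X = x" unfolding X_def by (rule coeff_Abs_poly[of r]) (simp add: xr)
  show ?thesis
  proof (rule that[of X])
    show "poly.coeff X i = 0" if "i \<ge> r" for i using that by (simp add: X xr)
    show "weight_ge \<mu> (of_nat (Suc s) * \<delta>) (X - (\<Sum>t<s. E t))" for s
      unfolding weight_ge_def
    proof (intro allI impI)
      fix i n assume "fls_nth (poly.coeff (X - (\<Sum>t<s. E t)) i) n \<noteq> 0"
      hence "fls_nth (x i) n \<noteq> (\<Sum>t<s. fls_nth (poly.coeff (E t) i) n)"
        by (simp add: X coeff_sum fls_nth_sum)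
      thus "of_nat (Suc s) * \<delta> \<le> weight \<mu> i n" using partial[of i n s] by linarith
    qed
  qed
qed

text \<open>The class of \<open>1\<close> in \<open>R/RQ\<close>, with \<open>Q = P\<^bsup>[\<mu>]\<^esup>\<close>, is annihilated by \<open>A\<close>
  up to positive weight, and \<open>A - 1\<close> multiplies positive weights by at least \<open>b\<close>; so
  the geometric series for the inverse of \<open>1 + (A - 1)\<close> corrects it to a class annihilated by
  \<open>A\<close>.\<close>

lemma exists_annihilated_class:
  assumes A: "weight_ge \<mu> 0 A" "poly.coeff A 0 = 1"
    and P: "reduction \<mu> A = P1 \<odot> P" "level_poly \<mu> P1" "level_poly \<mu> P" "degree P > 0"
  obtains X Y where "A \<star> X = Y \<star> conj_power \<mu> P" "X \<notin> range (\<lambda>c. c \<star> conj_power \<mu> P)"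
proof -
  define Q where "Q = conj_power \<mu> P"
  define r where "r = degree P"
  have degQ: "degree Q = r" using degree_conj_power[OF P(3)] by (simp add: Q_def r_def)
  have "P \<noteq> 0" using P(4) by auto
  from weight_division[OF P(3) this] obtain q \<rho>
    where division: "\<And>Z. Z = q Z \<star> Q + \<rho> Z"
      and \<rho>_coeff: "\<And>Z i. i \<ge> r \<Longrightarrow> poly.coeff (\<rho> Z) i = 0"
      and \<rho>_weight: "\<And>Z w. weight_ge \<mu> w Z \<Longrightarrow> weight_ge \<mu> w (\<rho> Z)"
    unfolding Q_def r_def by metis

  \<comment> \<open>\<open>N\<close> represents \<open>A\<close> modulo \<open>RQ\<close>; the
    reductions of \<open>A\<close> and of the subtracted product agree, so its weights are strictly
    positive.\<close>
  define N where "N = A - conj_power \<mu> P1 \<star> Q"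
  have "weight_ge \<mu> 0 N"
    unfolding N_def Q_def by (intro weight_ge_diff A weight_ge_skew_mult_left weight_ge_conj_power)
  moreover have "reduction \<mu> N = 0"
    unfolding N_def Q_def by (simp add: reduction_diff reduction_skew_mult weight_ge_conj_power reduction_conj_power P)
  ultimately obtain \<delta> where \<delta>: "\<delta> > 0" "weight_ge \<mu> \<delta> N" by (rule weight_ge_positive)

  define C where "C = A - 1"
  have "weight_ge \<mu> 0 1" by (auto simp: weight_ge_def weight_def split: if_splits)
  with A(1) have C_weight: "weight_ge \<mu> 0 C" unfolding C_def by (rule weight_ge_diff)
  have C_coeff: "i \<ge> 1" if "poly.coeff C i \<noteq> 0" for i
    using that A(2) by (cases i) (simp_all add: C_def)

  \<comment> \<open>Modulo \<open>RQ\<close>, \<open>E t\<close> is the \<open>t\<close>-th term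
    \<open>(-C)^t N\<close> of the geometric series, replaced by a remainder after each
    step.\<close>
  define E where "E = (\<lambda>t. ((\<lambda>Z. \<rho> (- (C \<star> Z))) ^^ t) (\<rho> N))"
  have E_Suc: "E (Suc t) = \<rho> (- (C \<star> E t))" for t by (simp add: E_def)
  have E_coeff: "poly.coeff (E t) i = 0" if "i \<ge> r" for t i
    by (cases t) (simp_all add: E_Suc \<rho>_coeff that, simp add: E_def \<rho>_coeff that)
  have E_weight: "weight_ge \<mu> (of_nat (Suc t) * \<delta>) (E t)" for t
  proof (induction t)
    case 0
    show ?case using \<rho>_weight[OF \<delta>(2)] by (simp add: E_def)
  next
    case (Suc t)
    have "weight_ge \<mu> (of_nat b ^ 1 * (of_nat (Suc t) * \<delta>)) (C \<star> E t)"
      using \<delta>(1) by (intro weight_ge_skew_mult_right C_weight C_coeff Suc.IH) auto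
    \<comment> \<open>Each application of \<open>C\<close> multiplies the weight by at least
      \<open>b \<ge> 2\<close>; already doubling gains one more \<open>\<delta>\<close>.\<close>
    moreover have "of_nat (Suc (Suc t)) * \<delta> \<le> of_nat b ^ 1 * (of_nat (Suc t) * \<delta>)"
    proof -
      have "Suc (Suc t) \<le> 2 * Suc t" by simp
      also have "\<dots> \<le> b * Suc t" using b_ge_2 by (intro mult_le_mono1)
      finally have "(of_nat (Suc (Suc t)) :: rat) \<le> of_nat (b * Suc t)" by (rule of_nat_mono)
      hence "of_nat (Suc (Suc t)) * \<delta> \<le> of_nat (b * Suc t) * \<delta>" using \<delta>(1) by (intro mult_right_mono) auto
      thus ?thesis by (simp only: of_nat_mult power_one_right mult.assoc)
    qed
    ultimately have "weight_ge \<mu> (of_nat (Suc (Suc t)) * \<delta>) (C \<star> E t)" by (rule weight_ge_mono)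
    thus ?case unfolding E_Suc by (intro \<rho>_weight) simp
  qed
  \<comment> \<open>Subtracting \<open>A \<star> E s = E s + C \<star> E s\<close> cancels the
    current error and leaves \<open>- (C \<star> E s)\<close>, whose remainder is the next
    error.\<close>
  have telescope: "\<exists>Y. A \<star> (1 - (\<Sum>t<s. E t)) = Y \<star> Q + E s" for s
  proof (induction s)
    case 0
    have "A = (conj_power \<mu> P1 + q N) \<star> Q + \<rho> N"
      using division[of N] by (simp add: N_def K.skew_add_left algebra_simps)
    thus ?case by (auto simp: E_def K.skew_one_right)
  next
    case (Suc s)
    then obtain Y where "A \<star> (1 - (\<Sum>t<s. E t)) = Y \<star> Q + E s" by blast
    hence "A \<star> (1 - (\<Sum>t<Suc s. E t)) = Y \<star> Q + E s - A \<star> E s"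
      by (simp add: K.skew_diff K.skew_add_right algebra_simps)
    also have "\<dots> = Y \<star> Q + (- (C \<star> E s))" by (simp add: C_def K.skew_diff K.skew_one_left)
    also have "\<dots> = Y \<star> Q + (q (- (C \<star> E s)) \<star> Q + \<rho> (- (C \<star> E s)))"
      by (simp only: division[symmetric])
    also have "\<dots> = (Y + q (- (C \<star> E s))) \<star> Q + E (Suc s)"
      by (simp add: K.skew_add_left E_Suc)
    finally show ?case by blast
  qed

  obtain X where X_coeff: "\<And>i. i \<ge> r \<Longrightarrow> poly.coeff X i = 0"
    and X_weight: "\<And>s. weight_ge \<mu> (of_nat (Suc s) * \<delta>) (X - (\<Sum>t<s. E t))"
    using weight_series_converges[OF \<delta>(1) E_weight E_coeff] by blast
  define W where "W = A \<star> (1 - X)"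
  define S where "S = \<rho> W"
  \<comment> \<open>Replacing \<open>X\<close> by its \<open>s\<close>-th partial sum shows that
    \<open>W\<close> is congruent to \<open>E s - \<rho> D\<close> modulo \<open>RQ\<close>;
    uniqueness of remainders turns this into equality with \<open>S\<close>. Holding for every
    \<open>s\<close>, the bound forces \<open>S = 0\<close>.\<close>
  have "weight_ge \<mu> (of_nat (Suc s) * \<delta>) S" for s
  proof -
    define D where "D = A \<star> (X - (\<Sum>t<s. E t))"
    have "weight_ge \<mu> (of_nat b ^ 0 * (of_nat (Suc s) * \<delta>)) D"
      unfolding D_def using \<delta>(1) by (intro weight_ge_skew_mult_right A X_weight) auto
    hence D: "weight_ge \<mu> (of_nat (Suc s) * \<delta>) (\<rho> D)" by (intro \<rho>_weight) simp
    obtain Y where Y: "A \<star> (1 - (\<Sum>t<s. E t)) = Y \<star> Q + E s" using telescope by blast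
    have "W = A \<star> (1 - (\<Sum>t<s. E t)) - D" by (simp add: W_def D_def K.skew_diff)
    also have "\<dots> = Y \<star> Q + E s - (q D \<star> Q + \<rho> D)" unfolding Y by (simp only: division[symmetric])
    finally have "q W \<star> Q + S = Y \<star> Q + E s - (q D \<star> Q + \<rho> D)"
      using division[of W] by (simp only: S_def)
    hence "(Y - q D - q W) \<star> Q = S - (E s - \<rho> D)"
      by (simp add: K.skew_diff K.skew_add_left algebra_simps)
    moreover have "poly.coeff (S - (E s - \<rho> D)) i = 0" if "i \<ge> r" for i
      using that by (simp add: S_def \<rho>_coeff E_coeff)
    ultimately have "S - (E s - \<rho> D) = 0"
      using K.skew_mult_small_degree_eq_0[of Q] degQ by metis
    moreover have "weight_ge \<mu> (of_nat (Suc s) * \<delta>) (E s - \<rho> D)"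
      by (intro weight_ge_diff E_weight D)
    ultimately show ?thesis by simp
  qed
  note S_weight = this
  have "S = 0"
  proof (rule poly_eqI, rule fls_eqI, rule ccontr)
    fix i n assume "fls_nth (poly.coeff S i) n \<noteq> fls_nth (poly.coeff 0 i) n"
    hence nz: "fls_nth (poly.coeff S i) n \<noteq> 0" by simp
    obtain s where "weight \<mu> i n < of_nat s * \<delta>" using ex_less_of_nat_mult[OF \<delta>(1)] by blast
    also have "\<dots> \<le> of_nat (Suc s) * \<delta>" using \<delta>(1) by (intro mult_right_mono) auto
    finally show False using weight_geD[OF S_weight nz, of s] by linarith
  qed
  hence AX: "A \<star> (1 - X) = q W \<star> Q" using division[of W] unfolding S_def W_def by simp
  \<comment> \<open>All coefficients of \<open>1 - X\<close> from \<open>r\<close> on vanish, so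
    membership would give \<open>X = 1\<close>; but \<open>1\<close> has weight \<open>0\<close> and
    \<open>X\<close> has weight at least \<open>\<delta>\<close>.\<close>
  have "1 - X \<notin> range (\<lambda>c. c \<star> Q)"
  proof
    assume "1 - X \<in> range (\<lambda>c. c \<star> Q)"
    then obtain c where c: "1 - X = c \<star> Q" by auto
    have "poly.coeff (1 - X) i = 0" if "i \<ge> degree Q" for i
      using that P(4) X_coeff degQ by (auto simp: coeff_1 r_def)
    hence "1 - X = 0" unfolding c by (rule K.skew_mult_small_degree_eq_0)
    hence "fls_nth (poly.coeff X 0) 0 \<noteq> 0" by simp
    with X_weight[of 0] have "\<delta> \<le> weight \<mu> 0 0" by (auto dest: weight_geD)
    thus False using \<delta>(1) by (simp add: weight_def)
  qed
  with AX show ?thesis unfolding Q_def by (rule that)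
qed

section \<open>The similarity, for vanishing and for nonvanishing constant coefficient\<close>

lemma irreducible_similar_conj_power:
  assumes A: "nc_irreducible (skew_poly_ring \<phi>) A"
  shows "\<exists>\<mu> P Q. \<mu> \<noteq> 0 \<and> nc_irreducible (skew_poly_subring \<sigma> (b_length b \<mu>)) P \<and>
    is_conj_power \<sigma> b \<mu> P Q \<and> similar (skew_poly_ring \<phi>) A Q"
proof (cases "poly.coeff A 0 = 0")
  case True
  \<comment> \<open>Here \<open>A\<close> is a left multiple of \<open>T\<close>. Slope
    \<open>1\<close> gives \<open>T^[1] = u^(b-1) T\<close>, which generates the same left ideal as
    \<open>T\<close>, so the class of \<open>1\<close> is annihilated by \<open>A\<close>.\<close>
  define P :: "'k poly" where "P = Polynomial.monom 1 1"
  have "level 1 i \<in> \<int>" for i by (simp add: level_def)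
  hence lev: "level_poly 1 P" and
    iff: "(if b_length b 1 = 0 then 1 else b_length b 1) dvd i" for i
    using b_length_dvd_iff[of 1 1] by (simp_all add: level_poly_def)
  have degP: "degree P = 1" by (simp add: P_def degree_monom_eq)
  have P: "nc_irreducible (skew_poly_subring \<sigma> (b_length b 1)) P"
    by (intro k.nc_irreducible_degree_1 degP) (use iff in \<open>simp add: k.carrier_skew_poly_subring\<close>)
  define Q where "Q = conj_power 1 P"
  have "degree Q = 1" using degree_conj_power[OF lev] degP by (simp add: Q_def)
  hence Q: "nc_irreducible (skew_poly_ring \<phi>) Q"
    using K.nc_irreducible_degree_1[of Q 0] by (simp add: K.skew_poly_subring_0)
  define T :: "'k fls poly" where "T = Polynomial.monom 1 1"
  have T: "T = [:fls_X_intpow (- (int b - 1)):] \<star> Q"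
  proof (rule poly_eqI)
    fix i
    have "fls_X_intpow (- (int b - 1)) * fls_X_intpow (int b - 1) = (1 :: 'k fls)"
      unfolding fls_X_intpow_times_fls_X_intpow by simp
    moreover have "\<lfloor>level 1 1\<rfloor> = int b - 1" by (simp add: level_def)
    ultimately show "poly.coeff T i = poly.coeff ([:fls_X_intpow (- (int b - 1)):] \<star> Q) i"
      using \<open>\<And>i. level 1 i \<in> \<int>\<close> by (auto simp: T_def Q_def coeff_conj_power P_def)
  qed
  obtain A' where A': "A = A' \<star> T"
  proof -
    define A' where "A' = poly_shift 1 A"
    have "poly.coeff (A' \<star> T) m = poly.coeff A m" for m
    proof (cases m)
      case 0
      thus ?thesis using True by (simp add: T_def)
    next
      case (Suc m')
      have "poly.coeff (A' \<star> T) m = (\<Sum>i\<le>m. if i = m' then poly.coeff A' m' else 0)"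
        unfolding K.coeff_skew_mult T_def Suc by (intro sum.cong) (auto simp: K.funpow_hom)
      also have "\<dots> = poly.coeff A m" using Suc by (simp add: A'_def coeff_poly_shift)
      finally show ?thesis .
    qed
    hence "A = A' \<star> T" by (intro poly_eqI) simp
    thus ?thesis by (rule that)
  qed
  have "1 \<notin> range (\<lambda>c. c \<star> Q)"
  proof
    assume "1 \<in> range (\<lambda>c. c \<star> Q)"
    then obtain c where c: "1 = c \<star> Q" by auto
    hence "c \<noteq> 0" "Q \<noteq> 0" by auto
    thus False using K.degree_skew_mult[of c Q] \<open>degree Q = 1\<close> by (simp flip: c)
  qed
  moreover have "A \<star> 1 = (A' \<star> [:fls_X_intpow (- (int b - 1)):]) \<star> Q"
    unfolding A' T by (simp add: K.skew_one_right K.skew_assoc)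
  ultimately have "similar (skew_poly_ring \<phi>) A Q" by (intro K.similar_if_right_mult[OF A Q])
  thus ?thesis
    using P is_conj_power_conj_power[OF lev] unfolding Q_def by (metis one_neq_zero)
next
  case False
  define a where "a = poly.coeff A 0"
  have a: "a \<noteq> 0" using False by (simp add: a_def)
  define A1 where "A1 = [:inverse a:] \<star> A"
  have "[:a:] \<star> [:inverse a:] = 1" using a by (simp add: K.const_skew_mult_const one_pCons)
  hence AA1: "A = [:a:] \<star> A1" unfolding A1_def by (metis K.skew_assoc K.skew_one_left)
  have A1: "poly.coeff A1 0 = fls_const 1" using a by (simp add: A1_def) (simp add: a_def)
  have "A1 \<noteq> 0" using A1 by auto
  hence "degree A1 > 0"
    using A K.degree_skew_mult[of "[:a:]" A1] a by (auto simp: AA1 K.nc_irreducible_skew_poly_ring)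
  then obtain \<mu> where \<mu>: "weight_ge \<mu> 0 A1" "degree (reduction \<mu> A1) > 0"
    using exists_slope A1 by blast
  define P0 where "P0 = reduction \<mu> A1"
  define j where "j = degree P0"
  have "poly.coeff P0 j \<noteq> 0" using \<mu>(2) by (auto simp: P0_def j_def)
  hence j: "level \<mu> j \<in> \<int>" "j > 0"
    using \<mu>(2) by (simp_all add: P0_def j_def coeff_reduction split: if_splits)
  \<comment> \<open>Slope \<open>0\<close> is not allowed in the conclusion. Slopes \<open>0\<close>
    and \<open>1\<close> both have integral levels everywhere, so the switch preserves the
    admissible exponents.\<close>
  define \<mu>' where "\<mu>' = (if \<mu> = 0 then 1 else \<mu>)"
  have \<mu>': "\<mu>' \<noteq> 0" by (simp add: \<mu>'_def)
  have "level 1 i \<in> \<int>" for i by (simp add: level_def)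
  hence same: "level \<mu>' i \<in> \<int> \<longleftrightarrow> level \<mu> i \<in> \<int>" for i by (simp add: \<mu>'_def)
  define l where "l = b_length b \<mu>'"
  have l: "(if l = 0 then 1 else l) dvd i \<longleftrightarrow> level \<mu>' i \<in> \<int>" for i
    unfolding l_def by (rule b_length_dvd_iff[OF \<mu>' _ j(2)]) (simp add: same j)
  have carrier: "X \<in> carrier (skew_poly_subring \<sigma> l) \<longleftrightarrow> level_poly \<mu> X" for X
    by (simp only: k.carrier_skew_poly_subring l same level_poly_def)
  have "P0 \<in> carrier (skew_poly_subring \<sigma> l)" by (simp add: carrier P0_def level_poly_reduction)
  moreover have "degree P0 > 0" using \<mu> by (simp add: P0_def)
  ultimately obtain P1 P where P: "P1 \<in> carrier (skew_poly_subring \<sigma> l)"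
    "nc_irreducible (skew_poly_subring \<sigma> l) P" "P0 = P1 \<odot> P"
    by (rule k.irreducible_right_factor)
  have P': "level_poly \<mu> P" "degree P > 0" "level_poly \<mu> P1"
    using P carrier by (auto simp: k.nc_irreducible_skew_poly_subring)
  have lev': "level_poly \<mu>' P" using P'(1) by (simp add: level_poly_def same)
  have "poly.coeff P0 0 = 1" using A1 by (simp add: P0_def coeff_reduction)
  hence "poly.coeff P 0 \<noteq> 0" by (auto simp: P)
  define Q where "Q = conj_power \<mu>' P"
  have Q: "nc_irreducible (skew_poly_ring \<phi>) Q"
    unfolding Q_def by (rule irreducible_conj_power[OF P(2) \<open>poly.coeff P 0 \<noteq> 0\<close> l])
  \<comment> \<open>\<open>w\<close> intertwines the two conjugates:
    \<open>u P^[1] = P^[0] u\<close> if the slope was changed, and \<open>w = 1\<close>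
    otherwise.\<close>
  have "\<exists>v w. [:w:] \<star> [:v:] = 1 \<and> conj_power \<mu> P \<star> [:w:] = [:w:] \<star> Q"
  proof (cases "\<mu> = 0")
    case True
    have "[:fls_X_intpow 1:] \<star> [:fls_X_intpow (- 1):] = 1"
      unfolding K.const_skew_mult_const fls_X_intpow_times_fls_X_intpow by (simp add: one_pCons)
    moreover have "conj_power \<mu> P \<star> [:fls_X_intpow 1:] = [:fls_X_intpow 1:] \<star> Q"
    proof (rule poly_eqI)
      fix i
      have "(\<phi> ^^ i) (fls_X_intpow 1) = fls_X_intpow (int b ^ i)"
        using funpow_fls_twist_X_intpow[of i 1 1] by (simp add: k.funpow_hom)
      moreover have "level 1 i = of_int (int b ^ i - 1)" by (simp add: level_def)
      hence "\<lfloor>level 1 i\<rfloor> = int b ^ i - 1" by (simp only: floor_of_int)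
      moreover have "fls_X_intpow 1 * fls_X_intpow (int b ^ i - 1) = (fls_X_intpow (int b ^ i) :: 'k fls)"
        unfolding fls_X_intpow_times_fls_X_intpow by simp
      ultimately show "poly.coeff (conj_power \<mu> P \<star> [:fls_X_intpow 1:]) i = poly.coeff ([:fls_X_intpow 1:] \<star> Q) i"
        using \<open>\<And>i. level 1 i \<in> \<int>\<close> True
        by (simp add: Q_def \<mu>'_def coeff_conj_power mult.left_commute del: fls_X_intpow_times_conv_shift)
    qed
    ultimately show ?thesis by blast
  next
    case False
    have "[:1:] \<star> [:1:] = 1" "conj_power \<mu> P \<star> [:1:] = [:1:] \<star> Q"
      using False by (simp_all add: K.skew_one_left K.skew_one_right Q_def \<mu>'_def flip: one_pCons)
    thus ?thesis by blast
  qed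
  then obtain v w where w: "[:w:] \<star> [:v:] = 1" "conj_power \<mu> P \<star> [:w:] = [:w:] \<star> Q" by blast
  have "poly.coeff A1 0 = 1" using A1 by simp
  from exists_annihilated_class[OF \<mu>(1) this P(3)[unfolded P0_def] P'(3,1,2)] obtain X Y
    where X: "A1 \<star> X = Y \<star> conj_power \<mu> P" "X \<notin> range (\<lambda>c. c \<star> conj_power \<mu> P)" by blast
  have "A \<star> (X \<star> [:w:]) = [:a:] \<star> ((A1 \<star> X) \<star> [:w:])" by (simp add: AA1 K.skew_assoc)
  also have "\<dots> = ([:a:] \<star> Y \<star> [:w:]) \<star> Q" unfolding X by (simp only: K.skew_assoc w)
  finally have "A \<star> (X \<star> [:w:]) = ([:a:] \<star> Y \<star> [:w:]) \<star> Q" .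
  \<comment> \<open>Right multiplication by the unit \<open>w\<close> carries the left ideal of
    \<open>conj_power \<mu> P\<close> onto that of \<open>Q\<close>, so \<open>v\<close> would bring
    a membership back to \<open>X\<close>.\<close>
  moreover have "X \<star> [:w:] \<notin> range (\<lambda>c. c \<star> Q)"
  proof
    assume "X \<star> [:w:] \<in> range (\<lambda>c. c \<star> Q)"
    then obtain c where c: "X \<star> [:w:] = c \<star> Q" by auto
    have "[:v:] \<star> [:w:] = 1"
      using w(1) by (simp add: K.const_skew_mult_const mult.commute)
    hence "[:v:] \<star> conj_power \<mu> P \<star> [:w:] = Q" by (metis w(2) K.skew_assoc K.skew_one_left)
    hence "X \<star> [:w:] = c \<star> [:v:] \<star> conj_power \<mu> P \<star> [:w:]" using c by (simp only: K.skew_assoc)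
    hence "X \<star> [:w:] \<star> [:v:] = c \<star> [:v:] \<star> conj_power \<mu> P \<star> [:w:] \<star> [:v:]" by simp
    hence "X = (c \<star> [:v:]) \<star> conj_power \<mu> P" by (simp only: K.skew_assoc w(1) K.skew_one_right)
    with X(2) show False by blast
  qed
  ultimately have "similar (skew_poly_ring \<phi>) A Q" by (rule K.similar_if_right_mult[OF A Q])
  moreover have "is_conj_power \<sigma> b \<mu>' P Q"
    unfolding Q_def by (rule is_conj_power_conj_power[OF lev'])
  ultimately show ?thesis using \<mu>' P(2) unfolding l_def by metis
qed

end

text \<open>Frobenius is additive in characteristic \<open>p\<close> and injective on a field;
  perfectness makes it bijective, so its inverse is an endomorphism as well and exponents of both
  signs are covered.\<close>

lemma skew_endo_frobenius_power:
  fixes \<sigma> :: "'k::field \<Rightarrow> 'k"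
  assumes "Factorial_Ring.prime p" "CHAR('k) = p" "surj (\<lambda>x::'k. x ^ p)" "is_frobenius_power p \<sigma>"
  shows "skew_endo \<sigma>"
proof -
  define F where "F = (\<lambda>x::'k. x ^ p)"
  interpret F: skew_field F
    using assms(1,2) by unfold_locales (simp_all add: F_def freshmans_dream power_mult_distrib)
  have "inj F"
  proof (rule injI)
    fix x y assume "F x = F y"
    hence "F (x - y) = 0" using F.add[of "x - y" y] by simp
    thus "x = y" using F.funpow_eq_0_iff[of 1 "x - y"] by simp
  qed
  define G where "G = inv_into UNIV F"
  have "surj F" using assms(3) unfolding F_def .
  hence FG: "F (G x) = x" for x unfolding G_def by (rule surj_f_inv_f)
  have GI: "x = G y" if "F x = y" for x y using that \<open>inj F\<close> by (auto simp: G_def)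
  interpret G: skew_field G
    by unfold_locales (auto intro!: GI[symmetric] simp: F.add F.mult F.one FG)
  obtain n where "\<sigma> = F ^^ n \<or> \<sigma> = G ^^ n"
    using assms(4) by (auto simp: is_frobenius_power_def F_def G_def)
  thus ?thesis
    by (auto intro!: skew_endo.intro simp: F.funpow_hom G.funpow_hom)
qed

theorem proposition5p8:
  fixes \<sigma> :: "'k::field \<Rightarrow> 'k" and p b :: nat and A :: "'k fls poly"
  assumes "Factorial_Ring.prime p" and "CHAR('k) = p"
    and "surj (\<lambda>x::'k. x ^ p)"
    and "is_frobenius_power p \<sigma>"
    and "b \<ge> 2"
    and "nc_irreducible (skew_poly_ring (fls_twist \<sigma> b)) A"
  shows "\<exists>\<mu>::rat. \<exists>P Q. \<mu> \<noteq> 0 \<and>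
           nc_irreducible (skew_poly_subring \<sigma> (b_length b \<mu>)) P \<and>
           is_conj_power \<sigma> b \<mu> P Q \<and>
           similar (skew_poly_ring (fls_twist \<sigma> b)) A Q"
proof -
  interpret mahler \<sigma> b
    using skew_endo_frobenius_power[OF assms(1-4)] assms(5)
    by (simp add: mahler_def mahler_axioms_def skew_field_def)
  show ?thesis by (rule irreducible_similar_conj_power[OF assms(6)])
qed

end
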